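(* Let $L$ be a finite dimensional complex simple Lie algebra (of any type $X_l$), let $V$ be a non-trivial irreducible $L$-module of dimension $n$, with corresponding injection $\rho:L\to sl_n\subset\mathrm{End}(V)$, and let $M$, $\delta_{res}$, $B$, $\eta$ be as defined in the context. Then $$2n\,\eta\circ(\mathrm{id}_{sl_n}\otimes B^{-1})\circ\delta_{res}=\mathrm{ad}_{\rho(L)}|_{\rho(L)}$$ as maps $\rho(L)\to\mathrm{End}(sl_n)$, where for $x\in L$ the endomorphism $\mathrm{ad}_{\rho(L)}|_{\rho(L)}(\rho(x))$ of $sl_n=\rho(L)\oplus M$ is $\mathrm{ad}(\rho(x))$ on $\rho(L)$ and zero on $M$; that is, for all $x,y\in L$ and $m\in M$, $$\left[2n\,\eta\circ(\mathrm{id}_{sl_n}\otimes B^{-1})\circ\delta_{res}\right](\rho(x))\,(\rho(y)+m)=[\rho(x),\rho(y)].$$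
   Context: A basis of $V$ is chosen so that $\mathrm{End}(V)=gl_n=gl_n(\mathbf{C})$ with matrix units $E_{i,j}$, and $sl_n=sl_n(\mathbf{C})$ carries the commutator bracket. The map $\delta: sl_n\to sl_n\otimes sl_n$ is the restriction to $sl_n$ of the linear map on $gl_n$ given by $\delta(E_{i,j})=\frac{1}{2n}\sum_{k=1}^{n}(E_{i,k}\otimes E_{k,j}-E_{k,j}\otimes E_{i,k})$; this restriction takes values in $sl_n\otimes sl_n$. Let $\{f_{i,j}\}_{1\le i,j\le n}$ be the basis of $(gl_n)^*$ with $f_{i,j}(E_{k,l})=\delta_{i,k}\delta_{j,l}$ (Kronecker deltas). The space $(sl_n)^*$ is regarded as a subspace of $(gl_n)^*$ by extending each functional on $sl_n$ to $gl_n=sl_n\oplus\mathbf{C}I$ by zero on the identity matrix $I$, and $B:(sl_n)^*\to sl_n$ is the linear isomorphism obtained by restricting the linear map $(gl_n)^*\to gl_n$, $f_{i,j}\mapsto E_{j,i}$. The bilinear form $(\cdot,\cdot)_B$ on $sl_n$ is $(x,y)_B=B^{-1}(x)(y)$; its restriction to $\rho(L)$ is non-degenerate. The map $\eta: sl_n\otimes(sl_n)^*\to\mathrm{End}(sl_n)$ is the isomorphism $\eta(x\otimes f)(y)=f(y)x$. $M=\{m\in sl_n\mid (m,\rho(L))_B=0\}$ is the orthogonal complement of $\rho(L)$; it is a $\rho(L)$-submodule and $sl_n=\rho(L)\oplus M$. Let $\mathrm{Proj}: sl_n\otimes sl_n\to\rho(L)\otimes\rho(L)$ be the projection with kernel $\rho(L)\otimes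 M+M\otimes\rho(L)+M\otimes M$, and set $\delta_{res}=\mathrm{Proj}\circ\delta|_{\rho(L)}:\rho(L)\to\rho(L)\otimes\rho(L)$. *)

theory Defs
  imports "HOL-Analysis.Analysis" "HOL-Library.Poly_Mapping" "HOL-Library.Function_Algebras"
begin

section \<open>Complex vector spaces\<close>

class complex_vector = ab_group_add +
  fixes scaleC :: "complex \<Rightarrow> 'a \<Rightarrow> 'a" (infixr "*\<^sub>C" 75)
  assumes scaleC_add_right: "c *\<^sub>C (x + y) = c *\<^sub>C x + c *\<^sub>C y"
    and scaleC_add_left: "(c + d) *\<^sub>C x = c *\<^sub>C x + d *\<^sub>C x"
    and scaleC_scaleC: "c *\<^sub>C d *\<^sub>C x = (c * d) *\<^sub>C x"
    and scaleC_one: "1 *\<^sub>C x = x"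

global_interpretation cvec: vector_space "scaleC :: complex \<Rightarrow> 'a::complex_vector \<Rightarrow> 'a"
  by unfold_locales (simp_all add: scaleC_add_right scaleC_add_left scaleC_scaleC scaleC_one)

abbreviation clin :: "('a::complex_vector \<Rightarrow> 'b::complex_vector) \<Rightarrow> bool"
  where "clin \<equiv> Vector_Spaces.linear scaleC scaleC"

definition finite_dim :: "'a::complex_vector set \<Rightarrow> bool"
  where "finite_dim S \<longleftrightarrow> (\<exists>B. finite B \<and> B \<subseteq> S \<and> S \<subseteq> cvec.span B)"

instantiation complex :: complex_vector
begin
definition scaleC_complex :: "complex \<Rightarrow> complex \<Rightarrow> complex"
  where "scaleC_complex c z = c * z"
instance by standard (simp_all add: scaleC_complex_def algebra_simps)
end

instantiation vec :: (complex_vector, finite) complex_vector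
begin
definition scaleC_vec :: "complex \<Rightarrow> 'a ^ 'b \<Rightarrow> 'a ^ 'b"
  where "scaleC_vec c v = (\<chi> i. c *\<^sub>C (v $ i))"
instance by standard
  (simp_all add: scaleC_vec_def vec_eq_iff scaleC_add_right scaleC_add_left scaleC_scaleC scaleC_one)
end

instantiation "fun" :: (type, complex_vector) complex_vector
begin
definition scaleC_fun :: "complex \<Rightarrow> ('a \<Rightarrow> 'b) \<Rightarrow> 'a \<Rightarrow> 'b"
  where "scaleC_fun c f = (\<lambda>x. c *\<^sub>C f x)"
instance by standard
  (simp_all add: scaleC_fun_def fun_eq_iff plus_fun_def scaleC_add_right scaleC_add_left scaleC_scaleC scaleC_one)
end

instantiation poly_mapping :: (type, complex_vector) complex_vector
begin
lift_definition scaleC_poly_mapping :: "complex \<Rightarrow> ('a \<Rightarrow>\<^sub>0 'b) \<Rightarrow> 'a \<Rightarrow>\<^sub>0 'b"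
  is "\<lambda>c f x. c *\<^sub>C f x"
  by (erule finite_subset[rotated]) auto
instance
  by standard (transfer, simp add: fun_eq_iff scaleC_add_right scaleC_add_left scaleC_scaleC scaleC_one)+
end


section \<open>Tensor products\<close>

text \<open>The algebraic tensor product over the complex numbers: the free vector space on
  pairs modulo the subspace spanned by the bilinearity relations.\<close>

definition tensor_relations ::
    "(('a::complex_vector \<times> 'b::complex_vector) \<Rightarrow>\<^sub>0 complex) set"
  where "tensor_relations =
    (let e = (\<lambda>x y. Poly_Mapping.single (x, y) 1) in
      {e (x + x') y - e x y - e x' y | x x' y. True}
    \<union> {e x (y + y') - e x y - e x y' | x y y'. True}
    \<union> {e (c *\<^sub>C x) y - c *\<^sub>C e x y | c x y. True}
    \<union> {e x (c *\<^sub>C y) - c *\<^sub>C e x y | c x y. True})"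

definition tensor_eq ::
    "(('a::complex_vector \<times> 'b::complex_vector) \<Rightarrow>\<^sub>0 complex) \<Rightarrow> ('a \<times> 'b \<Rightarrow>\<^sub>0 complex) \<Rightarrow> bool"
  where "tensor_eq p q \<longleftrightarrow> p - q \<in> cvec.span tensor_relations"

lemma equivp_tensor_eq:
  "equivp (tensor_eq :: ('a::complex_vector \<times> 'b::complex_vector \<Rightarrow>\<^sub>0 complex) \<Rightarrow> _)"
proof (rule equivpI)
  show "reflp (tensor_eq :: ('a \<times> 'b \<Rightarrow>\<^sub>0 complex) \<Rightarrow> _)"
    by (simp add: reflp_def tensor_eq_def cvec.span_zero)
  show "symp (tensor_eq :: ('a \<times> 'b \<Rightarrow>\<^sub>0 complex) \<Rightarrow> _)"
  proof (rule sympI)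
    fix p q :: "('a \<times> 'b) \<Rightarrow>\<^sub>0 complex"
    assume "tensor_eq p q"
    then show "tensor_eq q p"
      using cvec.span_neg[of "p - q" tensor_relations] by (simp add: tensor_eq_def)
  qed
  show "transp (tensor_eq :: ('a \<times> 'b \<Rightarrow>\<^sub>0 complex) \<Rightarrow> _)"
  proof (rule transpI)
    fix p q r :: "('a \<times> 'b) \<Rightarrow>\<^sub>0 complex"
    assume "tensor_eq p q" "tensor_eq q r"
    then show "tensor_eq p r"
      using cvec.span_add[of "p - q" tensor_relations "q - r"] by (simp add: tensor_eq_def)
  qed
qed

quotient_type (overloaded) ('a, 'b) tensor =
    "('a::complex_vector \<times> 'b::complex_vector) \<Rightarrow>\<^sub>0 complex" / tensor_eq
  by (rule equivp_tensor_eq)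

instantiation tensor :: (complex_vector, complex_vector) complex_vector
begin

lift_definition zero_tensor :: "('a, 'b) tensor" is 0 .

lift_definition plus_tensor :: "('a, 'b) tensor \<Rightarrow> ('a, 'b) tensor \<Rightarrow> ('a, 'b) tensor" is "(+)"
proof -
  fix p p' q q' :: "('a \<times> 'b) \<Rightarrow>\<^sub>0 complex"
  assume "tensor_eq p p'" "tensor_eq q q'"
  then show "tensor_eq (p + q) (p' + q')"
    using cvec.span_add[of "p - p'" tensor_relations "q - q'"]
    by (simp add: tensor_eq_def algebra_simps)
qed

lift_definition minus_tensor :: "('a, 'b) tensor \<Rightarrow> ('a, 'b) tensor \<Rightarrow> ('a, 'b) tensor" is "(-)"
proof -
  fix p p' q q' :: "('a \<times> 'b) \<Rightarrow>\<^sub>0 complex"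
  assume "tensor_eq p p'" "tensor_eq q q'"
  then show "tensor_eq (p - q) (p' - q')"
    using cvec.span_diff[of "p - p'" tensor_relations "q - q'"]
    by (simp add: tensor_eq_def algebra_simps)
qed

lift_definition uminus_tensor :: "('a, 'b) tensor \<Rightarrow> ('a, 'b) tensor" is uminus
proof -
  fix p p' :: "('a \<times> 'b) \<Rightarrow>\<^sub>0 complex"
  assume "tensor_eq p p'"
  then show "tensor_eq (- p) (- p')"
    using cvec.span_neg[of "p - p'" tensor_relations] by (simp add: tensor_eq_def)
qed

lift_definition scaleC_tensor :: "complex \<Rightarrow> ('a, 'b) tensor \<Rightarrow> ('a, 'b) tensor" is scaleC
proof -
  fix c and p p' :: "('a \<times> 'b) \<Rightarrow>\<^sub>0 complex"
  assume "tensor_eq p p'"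
  then show "tensor_eq (c *\<^sub>C p) (c *\<^sub>C p')"
    using cvec.span_scale[of "p - p'" tensor_relations c]
    by (simp add: tensor_eq_def cvec.scale_right_diff_distrib)
qed

instance
  by standard
    (transfer, simp add: tensor_eq_def cvec.span_zero scaleC_add_right scaleC_add_left
      scaleC_scaleC scaleC_one add.assoc add.commute)+

end

lift_definition tensor :: "'a::complex_vector \<Rightarrow> 'b::complex_vector \<Rightarrow> ('a, 'b) tensor"
    (infixl "\<otimes>\<^sub>C" 70)
  is "\<lambda>x y. Poly_Mapping.single (x, y) 1" .

text \<open>For subspaces \<open>S\<close> and \<open>T\<close>, the tensor product of \<open>S\<close> and \<open>T\<close> is identified with its
  (injective) image in the tensor product of the ambient spaces.\<close>

definition tensor_space ::
    "'a::complex_vector set \<Rightarrow> 'b::complex_vector set \<Rightarrow> ('a, 'b) tensor set"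
  where "tensor_space S T = cvec.span {x \<otimes>\<^sub>C y | x y. x \<in> S \<and> y \<in> T}"

text \<open>The following maps are determined by their specification only on \<^term>\<open>tensor_space S T\<close>
  (the first two) and on the sum of \<open>U\<close> and \<open>W\<close> (the third); they are used only there.
  Elsewhere the value is that of an arbitrary linear extension.\<close>

definition tensor_lift ::
    "'a::complex_vector set \<Rightarrow> 'b::complex_vector set \<Rightarrow> ('a \<Rightarrow> 'b \<Rightarrow> 'c::complex_vector)
      \<Rightarrow> ('a, 'b) tensor \<Rightarrow> 'c"
  where "tensor_lift S T \<beta> = (SOME h. clin h \<and> (\<forall>x\<in>S. \<forall>y\<in>T. h (x \<otimes>\<^sub>C y) = \<beta> x y))"

definition tensor_map ::
    "'a::complex_vector set \<Rightarrow> 'b::complex_vector set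
      \<Rightarrow> ('a \<Rightarrow> 'c::complex_vector) \<Rightarrow> ('b \<Rightarrow> 'd::complex_vector)
      \<Rightarrow> ('a, 'b) tensor \<Rightarrow> ('c, 'd) tensor"
  where "tensor_map S T f g = tensor_lift S T (\<lambda>x y. f x \<otimes>\<^sub>C g y)"

definition proj_along :: "'a::complex_vector set \<Rightarrow> 'a set \<Rightarrow> 'a \<Rightarrow> 'a"
  where "proj_along U W = (SOME p. clin p \<and> (\<forall>u\<in>U. p u = u) \<and> (\<forall>w\<in>W. p w = 0))"


section \<open>Lie algebras and modules\<close>

locale complex_lie_algebra =
  fixes bracket :: "'l::complex_vector \<Rightarrow> 'l \<Rightarrow> 'l"
  assumes linear_bracket_right: "clin (bracket x)"
    and linear_bracket_left: "clin (\<lambda>x. bracket x y)"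
    and bracket_self: "bracket x x = 0"
    and jacobi: "bracket x (bracket y z) + bracket y (bracket z x) + bracket z (bracket x y) = 0"
begin

definition lie_ideal :: "'l set \<Rightarrow> bool"
  where "lie_ideal I \<longleftrightarrow> cvec.subspace I \<and> (\<forall>x. \<forall>y\<in>I. bracket x y \<in> I)"

end

locale simple_lie_algebra = complex_lie_algebra +
  assumes non_abelian: "\<exists>x y. bracket x y \<noteq> 0"
    and simple: "lie_ideal I \<Longrightarrow> I = {0} \<or> I = UNIV"

locale lie_module = complex_lie_algebra bracket
  for bracket :: "'l::complex_vector \<Rightarrow> 'l \<Rightarrow> 'l" +
  fixes act :: "'l \<Rightarrow> 'v::complex_vector \<Rightarrow> 'v"
  assumes linear_act: "clin (act x)"
    and linear_act_left: "clin (\<lambda>x. act x v)"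
    and act_bracket: "act (bracket x y) v = act x (act y v) - act y (act x v)"
begin

definition submodule :: "'v set \<Rightarrow> bool"
  where "submodule W \<longleftrightarrow> cvec.subspace W \<and> (\<forall>x. \<forall>w\<in>W. act x w \<in> W)"

end

locale irreducible_lie_module = lie_module bracket act
  for bracket :: "'l::complex_vector \<Rightarrow> 'l \<Rightarrow> 'l"
    and act :: "'l \<Rightarrow> 'v::complex_vector \<Rightarrow> 'v" +
  assumes nonzero_module: "\<exists>v :: 'v. v \<noteq> 0"
    and irreducible: "submodule W \<Longrightarrow> W = {0} \<or> W = UNIV"

definition is_basis :: "('n \<Rightarrow> 'v::complex_vector) \<Rightarrow> bool"
  where "is_basis b \<longleftrightarrow> inj b \<and> cvec.independent (range b) \<and> cvec.span (range b) = UNIV"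

text \<open>Column \<open>j\<close> of the matrix of \<open>act x\<close> holds the coordinates of \<open>act x (b j)\<close>.\<close>

definition rep_matrix ::
    "('n::finite \<Rightarrow> 'v::complex_vector) \<Rightarrow> ('l \<Rightarrow> 'v \<Rightarrow> 'v) \<Rightarrow> 'l \<Rightarrow> complex ^ 'n ^ 'n"
  where "rep_matrix b act x = (\<chi> i j. cvec.representation (range b) (act x (b j)) (b i))"


section \<open>The Lie algebra of traceless matrices\<close>

type_synonym 'n gl = "complex ^ 'n ^ 'n"

definition commutator :: "'n::finite gl \<Rightarrow> 'n gl \<Rightarrow> 'n gl"
  where "commutator x y = x ** y - y ** x"

definition sl :: "'n::finite gl set"
  where "sl = {x. trace x = 0}"

definition mat_unit :: "'n::finite \<Rightarrow> 'n \<Rightarrow> 'n gl"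
  where "mat_unit i j = (\<chi> k l. if k = i \<and> l = j then 1 else 0)"

text \<open>The linear extension of the formula prescribed on the matrix units.\<close>

definition \<delta> :: "'n::finite gl \<Rightarrow> ('n gl, 'n gl) tensor"
  where "\<delta> x = (\<Sum>i\<in>UNIV. \<Sum>j\<in>UNIV. x $ i $ j *\<^sub>C
    (1 / (2 * of_nat CARD('n))) *\<^sub>C
    (\<Sum>k\<in>UNIV. mat_unit i k \<otimes>\<^sub>C mat_unit k j - mat_unit k j \<otimes>\<^sub>C mat_unit i k))"

text \<open>Functionals on \<open>sl\<close>, extended by zero on the identity matrix.\<close>

definition sl_dual :: "('n::finite gl \<Rightarrow> complex) set"
  where "sl_dual = {f. clin f \<and> f (mat 1) = 0}"

text \<open>As a functional \<open>f\<close> on matrices is the sum over \<open>i, j\<close> of \<open>f (mat_unit i j)\<close> times the dual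
  basis vector belonging to \<open>(i, j)\<close>, this is the linear map sending that dual basis vector to
  \<open>mat_unit j i\<close>.\<close>

definition B_map :: "('n::finite gl \<Rightarrow> complex) \<Rightarrow> 'n gl"
  where "B_map f = (\<Sum>i\<in>UNIV. \<Sum>j\<in>UNIV. f (mat_unit i j) *\<^sub>C mat_unit j i)"

definition B_inv :: "'n::finite gl \<Rightarrow> 'n gl \<Rightarrow> complex"
  where "B_inv = inv_into sl_dual B_map"

definition form_B :: "'n::finite gl \<Rightarrow> 'n gl \<Rightarrow> complex"
  where "form_B x y = B_inv x y"

definition \<eta> :: "('n::finite gl, 'n gl \<Rightarrow> complex) tensor \<Rightarrow> 'n gl \<Rightarrow> 'n gl"
  where "\<eta> = tensor_lift sl sl_dual (\<lambda>x f y. f y *\<^sub>C x)"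

text \<open>In the remaining definitions \<open>R\<close> stands for the image of the representation.\<close>

definition orth :: "'n::finite gl set \<Rightarrow> 'n gl set"
  where "orth R = {m \<in> sl. \<forall>r\<in>R. form_B m r = 0}"

definition Proj :: "'n::finite gl set \<Rightarrow> ('n gl, 'n gl) tensor \<Rightarrow> ('n gl, 'n gl) tensor"
  where "Proj R = proj_along (tensor_space R R)
    {a + b + c | a b c. a \<in> tensor_space R (orth R) \<and> b \<in> tensor_space (orth R) R
      \<and> c \<in> tensor_space (orth R) (orth R)}"

definition \<delta>_res :: "'n::finite gl set \<Rightarrow> 'n gl \<Rightarrow> ('n gl, 'n gl) tensor"
  where "\<delta>_res R = Proj R \<circ> \<delta>"

text \<open>\<open>ad x\<close> on \<open>R\<close> and zero on the orthogonal complement.\<close>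

definition ad_res :: "'n::finite gl set \<Rightarrow> 'n gl \<Rightarrow> 'n gl \<Rightarrow> 'n gl"
  where "ad_res R x z = commutator x (proj_along R (orth R) z)"

end

theory Submission
  imports Defs "HOL-Computational_Algebra.Fundamental_Theorem_Algebra"
begin

text \<open>
  The form \<open>(x, y)\<^sub>B\<close> is the trace form \<open>trace (x y)\<close>: the functional \<open>B\<^sup>-\<^sup>1 x\<close> is
  \<open>y \<mapsto> trace (x y)\<close> (\<open>B_inv_eq\<close>). Write \<open>R\<close> for the image of \<open>L\<close>, let \<open>proj\<close> be the projection of
  all matrices onto \<open>R\<close> along the trace-orthogonal complement of \<open>R\<close>, and let \<open>E\<^sub>i\<^sub>j\<close> be the matrix
  units. The projection of tensors is \<open>proj \<otimes> proj\<close> on \<open>sl \<otimes> sl\<close>, so that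
  \<open>\<eta> \<circ> (id \<otimes> B\<^sup>-\<^sup>1) \<circ> Proj\<close> sends \<open>x \<otimes> y\<close> to the map \<open>z \<mapsto> trace (proj y z) proj x\<close>. This vanishes
  for \<open>z\<close> orthogonal to \<open>R\<close>. For \<open>z\<close> in \<open>R\<close> it equals \<open>proj (trace (y z) x)\<close>, and summing over the
  terms \<open>E\<^sub>i\<^sub>k \<otimes> E\<^sub>k\<^sub>j - E\<^sub>k\<^sub>j \<otimes> E\<^sub>i\<^sub>k\<close> of \<open>2 n \<delta> X\<close>, with \<open>trace (E\<^sub>k\<^sub>j z)\<close> an entry of \<open>z\<close>, yields
  \<open>proj (X z - z X)\<close>, which is \<open>[X, z]\<close> because \<open>R\<close> is closed under commutators
  (\<open>\<eta>_\<delta>_res_eq_commutator\<close>).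

  The substance lies in the existence of \<open>proj\<close>, that is, in the non-degeneracy of the trace form on
  \<open>R\<close> (\<open>trace_form_nondegenerate\<close>). The radical of the form pulls back to an ideal of the simple Lie
  algebra \<open>L\<close>, so if the form is degenerate on \<open>R\<close>, it vanishes there. Cartan's argument then
  shows that every \<open>X\<close> in \<open>R\<close> is nilpotent (\<open>trace_form_zero_imp_nilpotent\<close>): let \<open>Y\<close> act on the
  generalized eigenspace of \<open>X\<close> for \<open>\<mu>\<close> as the complex conjugate of \<open>\<mu>\<close>. Then \<open>trace (Y X)\<close> is the
  sum of all \<open>\<bar>\<mu>\<bar>\<^sup>2\<close>, counted with multiplicity. On the other hand \<open>X\<close> is a sum of commutators
  \<open>[a, b]\<close>, since \<open>L\<close> is perfect, and \<open>trace (Y [a, b]) = trace ([Y, a] b) = 0\<close>, since \<open>[Y, a]\<close> lies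
  again in \<open>R\<close>. Engel's theorem (\<open>engel_nilpotent\<close>) now provides a non-zero vector of \<open>V\<close> killed by
  \<open>L\<close>, which is impossible in a non-trivial irreducible module.

  The linear algebra behind this is the primary decomposition of a finite-dimensional invariant
  subspace (\<open>primary_decomposition\<close>), used both for \<open>X\<close> on column vectors and for \<open>ad X\<close> on \<open>R\<close>, and
  a basis of generalized eigenvectors in which \<open>X\<close> is triangular (\<open>triangular_basis\<close>), which
  computes the trace.
\<close>

section \<open>Generalized eigenspaces\<close>

lemma clinI:
  assumes "\<And>x y. f (x + y) = f x + f y" and "\<And>c x. f (c *\<^sub>C x) = c *\<^sub>C f x"
  shows "clin f"
  using assms by unfold_locales auto

context
  fixes f :: "'a::complex_vector \<Rightarrow> 'b::complex_vector"
  assumes f: "clin f"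
begin

interpretation f: module_hom scaleC scaleC f
  using f by (simp add: Vector_Spaces.linear_def)

lemma clin_add: "f (x + y) = f x + f y" by (rule f.add)
lemma clin_diff: "f (x - y) = f x - f y" by (rule f.diff)
lemma clin_scale: "f (c *\<^sub>C x) = c *\<^sub>C f x" by (rule f.scale)
lemma clin_zero: "f 0 = 0" by (rule f.zero)
lemma clin_minus: "f (- x) = - f x" by (rule f.neg)
lemma clin_sum: "f (\<Sum>i\<in>I. g i) = (\<Sum>i\<in>I. f (g i))" by (rule f.sum)

end

lemma span_in_subspace:
  "x \<in> cvec.span S \<Longrightarrow> cvec.subspace W \<Longrightarrow> S \<subseteq> W \<Longrightarrow> x \<in> W"
  using cvec.span_minimal by blast

lemma clin_span_in_subspace:
  assumes "clin f" and "x \<in> cvec.span S" and "cvec.subspace W" and "\<And>s. s \<in> S \<Longrightarrow> f s \<in> W"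
  shows "f x \<in> W"
proof (rule span_in_subspace[of x S "{v. f v \<in> W}", simplified])
  show "cvec.subspace {v. f v \<in> W}"
    using assms(1,3) by (auto simp: cvec.subspace_def clin_zero clin_add clin_scale)
qed (use assms in auto)

lemma clin_eq_on_span:
  assumes "clin f" and "clin g" and "x \<in> cvec.span S" and "\<And>s. s \<in> S \<Longrightarrow> f s = g s"
  shows "f x = g x"
proof (rule span_in_subspace[of x S "{v. f v = g v}", simplified])
  show "cvec.subspace {v. f v = g v}"
    using assms(1,2) by (auto simp: cvec.subspace_def clin_zero clin_add clin_scale)
qed (use assms in auto)

definition shift :: "('a::complex_vector \<Rightarrow> 'a) \<Rightarrow> complex \<Rightarrow> 'a \<Rightarrow> 'a"
  where "shift f \<mu> v = f v - \<mu> *\<^sub>C v"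

definition gen_eig :: "('a::complex_vector \<Rightarrow> 'a) \<Rightarrow> complex \<Rightarrow> 'a set"
  where "gen_eig f \<mu> = {v. \<exists>N. (shift f \<mu> ^^ N) v = 0}"

lemma clin_shift: "clin f \<Longrightarrow> clin (shift f \<mu>)"
  by (rule clinI) (auto simp: shift_def clin_add clin_scale cvec.scale_right_distrib
      cvec.scale_right_diff_distrib cvec.scale_left_commute)

lemma clin_funpow:
  fixes f :: "'a::complex_vector \<Rightarrow> 'a"
  assumes "clin f" shows "clin (f ^^ N)"
proof (rule clinI)
  show "(f ^^ N) (x + y) = (f ^^ N) x + (f ^^ N) y" for x y
    by (induction N) (simp_all add: clin_add[OF assms])
  show "(f ^^ N) (c *\<^sub>C x) = c *\<^sub>C (f ^^ N) x" for c x
    by (induction N) (simp_all add: clin_scale[OF assms])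
qed

lemma shift_commute: "clin f \<Longrightarrow> shift f \<mu> (shift f \<nu> v) = shift f \<nu> (shift f \<mu> v)"
  by (simp add: shift_def clin_diff clin_scale cvec.scale_right_diff_distrib cvec.scale_left_commute)

lemma funpow_commute:
  fixes f g :: "'a \<Rightarrow> 'a"
  assumes "\<And>v. f (g v) = g (f v)"
  shows "(f ^^ N) (g v) = g ((f ^^ N) v)"
  by (induction N) (auto simp: assms)

lemma funpow_zero_mono:
  fixes f :: "'a::complex_vector \<Rightarrow> 'a"
  assumes "clin f" and "(f ^^ N) v = 0" and "N \<le> K"
  shows "(f ^^ K) v = 0"
proof -
  have "(f ^^ K) v = (f ^^ (K - N)) ((f ^^ N) v)"
    using assms(3) by (metis funpow_add le_add_diff_inverse2 o_apply)
  then show ?thesis using assms(1,2) by (simp add: clin_zero clin_funpow)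
qed

lemma subspace_gen_eig:
  assumes "clin f" shows "cvec.subspace (gen_eig f \<mu>)"
  unfolding cvec.subspace_def
proof (intro conjI ballI allI)
  let ?s = "shift f \<mu>"
  have lin: "clin ?s" by (rule clin_shift[OF assms])
  have linp: "clin (?s ^^ K)" for K by (rule clin_funpow[OF lin])
  show "0 \<in> gen_eig f \<mu>"
    by (auto simp: gen_eig_def intro: exI[of _ 0])
  fix v assume "v \<in> gen_eig f \<mu>"
  then obtain N where N: "(?s ^^ N) v = 0" by (auto simp: gen_eig_def)
  show "c *\<^sub>C v \<in> gen_eig f \<mu>" for c
    using N by (auto simp: gen_eig_def clin_scale[OF linp] intro!: exI[of _ N])
  fix w assume "w \<in> gen_eig f \<mu>"
  then obtain K where K: "(?s ^^ K) w = 0" by (auto simp: gen_eig_def)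
  have "(?s ^^ max N K) (v + w) = 0"
    using funpow_zero_mono[OF lin N, of "max N K"] funpow_zero_mono[OF lin K, of "max N K"]
    by (simp add: clin_add[OF linp])
  then show "v + w \<in> gen_eig f \<mu>" by (auto simp: gen_eig_def)
qed

lemma gen_eig_step:
  assumes "clin f" and "shift f \<mu> v \<in> gen_eig f \<mu>"
  shows "v \<in> gen_eig f \<mu>"
proof -
  obtain N where "(shift f \<mu> ^^ N) (shift f \<mu> v) = 0" using assms by (auto simp: gen_eig_def)
  then have "(shift f \<mu> ^^ Suc N) v = 0" by (simp add: funpow_swap1)
  then show ?thesis unfolding gen_eig_def by blast
qed

lemma gen_eig_shift:
  assumes "clin f" and "v \<in> gen_eig f \<mu>"
  shows "shift f \<nu> v \<in> gen_eig f \<mu>"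
proof -
  obtain N where "(shift f \<mu> ^^ N) v = 0" using assms by (auto simp: gen_eig_def)
  then have "(shift f \<mu> ^^ N) (shift f \<nu> v) = 0"
    by (subst funpow_commute) (auto simp: shift_commute assms(1) clin_zero clin_shift)
  then show ?thesis unfolding gen_eig_def by blast
qed

text \<open>If \<open>f v = \<nu> v\<close>, then \<open>f - \<mu>\<close> acts on \<open>v\<close> as the non-zero scalar \<open>\<nu> - \<mu>\<close>, so no power
  of it kills a non-zero \<open>v\<close>. Descending along the powers of \<open>f - \<nu>\<close> extends this from
  eigenvectors to generalized eigenvectors.\<close>

lemma gen_eig_disjoint:
  assumes f: "clin f" and v: "v \<in> gen_eig f \<mu>" "v \<in> gen_eig f \<nu>" and ne: "\<mu> \<noteq> \<nu>"
  shows "v = 0"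
proof -
  have *: "w = 0" if w: "w \<in> gen_eig f \<mu>" and 0: "shift f \<nu> w = 0" for w
  proof -
    obtain N where N: "(shift f \<mu> ^^ N) w = 0" using w by (auto simp: gen_eig_def)
    have "shift f \<mu> w = (\<nu> - \<mu>) *\<^sub>C w"
      using 0 by (simp add: shift_def cvec.scale_left_diff_distrib)
    then have "(shift f \<mu> ^^ K) w = (\<nu> - \<mu>) ^ K *\<^sub>C w" for K
      by (induction K) (auto simp: clin_scale[OF clin_shift[OF f]] mult.commute)
    with N ne show "w = 0" by simp
  qed
  obtain N where "(shift f \<nu> ^^ N) v = 0" using v by (auto simp: gen_eig_def)
  then show ?thesis
  proof (induction N)
    case (Suc N)
    have "(shift f \<nu> ^^ N) v \<in> gen_eig f \<mu>"
      by (induction N) (use v gen_eig_shift[OF f] in auto)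
    with Suc * show ?case by auto
  qed auto
qed

text \<open>A power of \<open>f - a\<close> that kills the component for \<open>a\<close> is injective on the other
  generalized eigenspaces, so a vanishing sum loses one term at a time.\<close>

lemma gen_eig_independent:
  assumes f: "clin f" and "finite F" and "\<And>\<mu>. \<mu> \<in> F \<Longrightarrow> v \<mu> \<in> gen_eig f \<mu>"
    and "(\<Sum>\<mu>\<in>F. v \<mu>) = 0" and "\<mu> \<in> F"
  shows "v \<mu> = 0"
  using assms(2-)
proof (induction F arbitrary: v \<mu> rule: finite_induct)
  case (insert a F)
  obtain N where N: "(shift f a ^^ N) (v a) = 0"
    using insert.prems(1)[of a] by (auto simp: gen_eig_def)
  let ?s = "shift f a ^^ N"
  have lin: "clin ?s" by (intro clin_funpow clin_shift f)
  have zero: "v \<nu> = 0" if \<nu>: "\<nu> \<in> F" for \<nu>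
  proof -
    have "?s w \<in> gen_eig f \<kappa>" if "w \<in> gen_eig f \<kappa>" for w \<kappa>
      by (induction N) (use that gen_eig_shift[OF f] in auto)
    moreover have "(\<Sum>\<kappa>\<in>F. ?s (v \<kappa>)) = 0"
    proof -
      have "?s (\<Sum>\<kappa>\<in>insert a F. v \<kappa>) = 0" using insert.prems(2) by (simp add: clin_zero[OF lin])
      then show ?thesis using insert.hyps N by (simp add: clin_add[OF lin] clin_sum[OF lin])
    qed
    ultimately have "?s (v \<nu>) = 0"
      using insert.IH[of "\<lambda>\<kappa>. ?s (v \<kappa>)" \<nu>] insert.prems(1) \<nu> by auto
    then have "v \<nu> \<in> gen_eig f a" by (auto simp: gen_eig_def)
    with gen_eig_disjoint[OF f] insert.prems(1) \<nu> insert.hyps show ?thesis by blast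
  qed
  then have "v a = 0" using insert by simp
  with zero insert.prems(3) show ?case by auto
qed simp

section \<open>Primary decomposition\<close>

text \<open>This is \<open>p(f) w\<close>, evaluated by Horner's scheme.\<close>

definition peval :: "('a::complex_vector \<Rightarrow> 'a) \<Rightarrow> complex poly \<Rightarrow> 'a \<Rightarrow> 'a"
  where "peval f p w = fold_coeffs (\<lambda>c v. c *\<^sub>C w + f v) p 0"

context
  fixes f :: "'a::complex_vector \<Rightarrow> 'a"
  assumes f: "clin f"
begin

lemma peval_0 [simp]: "peval f 0 w = 0"
  by (simp add: peval_def)

lemma peval_pCons [simp]: "peval f (pCons c p) w = c *\<^sub>C w + f (peval f p w)"
  by (cases "c = 0 \<and> p = 0") (auto simp: peval_def clin_zero[OF f])

lemma peval_add: "peval f (p + q) w = peval f p w + peval f q w"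
  by (induction p q rule: poly_induct2)
    (auto simp: clin_add[OF f] cvec.scale_left_distrib algebra_simps)

lemma peval_smult: "peval f (smult c p) w = c *\<^sub>C peval f p w"
  by (induction p) (auto simp: clin_scale[OF f] cvec.scale_right_distrib)

lemma peval_sum: "peval f (\<Sum>i\<in>I. p i) w = (\<Sum>i\<in>I. peval f (p i) w)"
  by (induction I rule: infinite_finite_induct) (auto simp: peval_add)

lemma peval_monom: "peval f (monom c n) w = c *\<^sub>C (f ^^ n) w"
  by (induction n) (auto simp: monom_Suc clin_scale[OF f] monom_0 clin_zero[OF f])

lemma peval_linear_factor: "peval f ([:- a, 1:] * q) w = peval f q (shift f a w)"
proof -
  have "peval f q (shift f a w) = f (peval f q w) - a *\<^sub>C peval f q w"
    by (induction q) (auto simp: shift_def clin_add[OF f] clin_diff[OF f] clin_scale[OF f]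
        cvec.scale_right_distrib cvec.scale_right_diff_distrib mult.commute clin_zero[OF f])
  then show ?thesis
    using peval_add[of "pCons 0 q" "smult (- a) q" w] peval_smult[of "- a" q w]
    by simp
qed

text \<open>On the generalized eigenspace of \<open>\<mu> \<noteq> a\<close> the operator \<open>f - a\<close> is invertible, being the
  non-zero scalar \<open>\<mu> - a\<close> plus a nilpotent operator; the induction builds a preimage.\<close>

lemma gen_eig_shift_surj:
  assumes W: "cvec.subspace W" "\<And>w. w \<in> W \<Longrightarrow> f w \<in> W" and ne: "\<mu> \<noteq> a"
    and u: "u \<in> W" "u \<in> gen_eig f \<mu>"
  shows "\<exists>w\<in>W \<inter> gen_eig f \<mu>. shift f a w = u"
proof -
  obtain N where "(shift f \<mu> ^^ N) u = 0" using u by (auto simp: gen_eig_def)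
  with u show ?thesis
  proof (induction N arbitrary: u)
    case 0
    then show ?case
      using W(1) subspace_gen_eig[OF f, of \<mu>]
      by (auto intro!: bexI[of _ 0] simp: cvec.subspace_0 shift_def clin_zero[OF f])
  next
    case (Suc N)
    let ?u = "shift f \<mu> u"
    have "?u \<in> W" using Suc.prems W by (simp add: shift_def cvec.subspace_diff cvec.subspace_scale)
    moreover have "?u \<in> gen_eig f \<mu>" using Suc.prems f by (simp add: gen_eig_shift)
    moreover have "(shift f \<mu> ^^ N) ?u = 0" using Suc.prems by (simp add: funpow_swap1)
    ultimately obtain w where w: "w \<in> W" "w \<in> gen_eig f \<mu>" "shift f a w = ?u"
      using Suc.IH by blast
    let ?v = "(1 / (\<mu> - a)) *\<^sub>C (u - w)"
    have "shift f a (u - w) = (\<mu> - a) *\<^sub>C u"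
      using w(3) by (simp add: clin_diff[OF clin_shift[OF f]]) (simp add: shift_def cvec.scale_left_diff_distrib)
    then have "shift f a ?v = u"
      using ne by (simp add: clin_scale[OF clin_shift[OF f]])
    moreover have "?v \<in> W \<inter> gen_eig f \<mu>"
      using Suc.prems w W(1) subspace_gen_eig[OF f, of \<mu>]
      by (auto intro!: cvec.subspace_scale cvec.subspace_diff)
    ultimately show ?case by blast
  qed
qed

text \<open>Splitting off one root \<open>a\<close> of \<open>p\<close> lowers the degree: \<open>(f - a) w\<close> decomposes by
  induction, the components for eigenvalues other than \<open>a\<close> are images under \<open>f - a\<close>, and what
  remains of \<open>w\<close> lies in the generalized eigenspace of \<open>a\<close>.\<close>

lemma annihilated_in_span_gen_eig:
  assumes W: "cvec.subspace W" "\<And>w. w \<in> W \<Longrightarrow> f w \<in> W"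
    and "w \<in> W" and "p \<noteq> 0" and "peval f p w = 0"
  shows "w \<in> cvec.span (W \<inter> (\<Union>\<mu>. gen_eig f \<mu>))" (is "_ \<in> cvec.span ?G")
  using assms(3-)
proof (induction "degree p" arbitrary: p w)
  case 0
  then obtain c where "p = [:c:]" "c \<noteq> 0" by (metis degree_eq_zeroE pCons_0_0)
  with 0 show ?case by (simp add: clin_zero[OF f] cvec.span_zero)
next
  case (Suc d)
  then have "\<not> constant (poly p)" by (simp add: constant_degree)
  then obtain a where "poly p a = 0" using fundamental_theorem_of_algebra by blast
  then obtain q where q: "p = [:- a, 1:] * q" by (auto simp: poly_eq_0_iff_dvd elim: dvdE)
  with Suc.prems have "q \<noteq> 0" by auto
  then have "degree p = Suc (degree q)"
    unfolding q by (subst degree_mult_eq) auto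
  then have deg: "d = degree q" using Suc.hyps by simp
  let ?s = "shift f a"
  have lin: "clin ?s" by (rule clin_shift[OF f])
  have sw: "?s w \<in> W" using W Suc.prems by (simp add: shift_def cvec.subspace_diff cvec.subspace_scale)
  have "peval f q (?s w) = 0" using Suc.prems q by (metis peval_linear_factor)
  from Suc.hyps(1)[OF deg sw \<open>q \<noteq> 0\<close> this] have "?s w \<in> cvec.span ?G" .
  then have "\<exists>w'\<in>cvec.span ?G. ?s w - ?s w' \<in> gen_eig f a \<and> w' \<in> W"
  proof (induction rule: cvec.span_induct_alt)
    case base
    then show ?case using subspace_gen_eig[OF f, of a] W(1)
      by (auto intro!: bexI[of _ 0] simp: clin_zero[OF lin] cvec.subspace_0 cvec.span_zero)
  next
    case (step c u y)
    then obtain w' where w': "w' \<in> cvec.span ?G" "y - ?s w' \<in> gen_eig f a" "w' \<in> W" by blast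
    from step obtain \<mu> where \<mu>: "u \<in> W" "u \<in> gen_eig f \<mu>" by blast
    show ?case
    proof (cases "\<mu> = a")
      case True
      have "c *\<^sub>C u + y - ?s w' = c *\<^sub>C u + (y - ?s w')" by simp
      also have "\<dots> \<in> gen_eig f a"
        using subspace_gen_eig[OF f, of a] \<mu> w' unfolding True
        by (intro cvec.subspace_add cvec.subspace_scale)
      finally show ?thesis using w' by blast
    next
      case False
      obtain v where v: "v \<in> W" "v \<in> gen_eig f \<mu>" "?s v = u"
        using gen_eig_shift_surj[OF W False \<mu>] by blast
      have "v \<in> cvec.span ?G" using v by (auto intro: cvec.span_base)
      then have "c *\<^sub>C v + w' \<in> cvec.span ?G" "c *\<^sub>C v + w' \<in> W"
        using w' v W(1) by (auto intro!: cvec.span_add cvec.span_scale cvec.subspace_add cvec.subspace_scale)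
      moreover have "c *\<^sub>C u + y - ?s (c *\<^sub>C v + w') = y - ?s w'"
        using v(3) by (simp add: clin_add[OF lin] clin_scale[OF lin])
      ultimately show ?thesis using w' by (metis (no_types, lifting))
    qed
  qed
  then obtain w' where w': "w' \<in> cvec.span ?G" "?s w - ?s w' \<in> gen_eig f a" "w' \<in> W" by blast
  have "?s (w - w') \<in> gen_eig f a" using w'(2) by (simp only: clin_diff[OF lin])
  then have "w - w' \<in> gen_eig f a" by (rule gen_eig_step[OF f])
  moreover have "w - w' \<in> W" using w' Suc.prems W by (simp add: cvec.subspace_diff)
  ultimately have "w - w' \<in> cvec.span ?G" by (auto intro: cvec.span_base)
  from cvec.span_add[OF this w'(1)] show ?case by simp
qed

text \<open>Among \<open>w, f w, \<dots>, f\<^sup>d w\<close> with \<open>d = card B\<close> there is a repetition or a linear dependence;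
  either gives a polynomial.\<close>

lemma annihilating_poly_exists:
  assumes "finite B" and "\<And>i. (f ^^ i) w \<in> cvec.span B"
  shows "\<exists>p. p \<noteq> 0 \<and> peval f p w = 0"
proof (cases "inj_on (\<lambda>i. (f ^^ i) w) {..card B}")
  case False
  then obtain i j where ij: "i \<noteq> j" "(f ^^ i) w = (f ^^ j) w" by (auto simp: inj_on_def)
  let ?p = "monom 1 i + monom (- 1) j :: complex poly"
  have "coeff ?p i = 1" using ij by simp
  then have "?p \<noteq> 0" by (metis coeff_0 zero_neq_one)
  moreover have "peval f ?p w = 0" using ij by (simp add: peval_add peval_monom)
  ultimately show ?thesis by blast
next
  case True
  let ?S = "(\<lambda>i. (f ^^ i) w) ` {..card B}"
  have "card ?S = Suc (card B)" using True by (simp add: card_image)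
  then have "cvec.dependent ?S"
    using cvec.independent_span_bound[OF assms(1), of ?S] assms(2) by fastforce
  then obtain u v where u: "v \<in> ?S" "u v \<noteq> 0" "(\<Sum>v\<in>?S. u v *\<^sub>C v) = 0"
    using cvec.dependent_finite[of ?S] by auto
  define c where "c i = u ((f ^^ i) w)" for i
  let ?p = "\<Sum>i\<le>card B. monom (c i) i"
  have "(\<Sum>i\<le>card B. c i *\<^sub>C (f ^^ i) w) = 0"
    using u(3) True by (subst (asm) sum.reindex) (auto simp: c_def)
  then have "peval f ?p w = 0" by (simp add: peval_sum peval_monom)
  moreover from u obtain i where "i \<le> card B" "c i \<noteq> 0" by (auto simp: c_def)
  then have "coeff ?p i \<noteq> 0" by (simp add: coeff_sum)
  then have "?p \<noteq> 0" by (metis coeff_0)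
  ultimately show ?thesis by blast
qed

theorem primary_decomposition:
  assumes "finite B" and W: "cvec.subspace W" "\<And>w. w \<in> W \<Longrightarrow> f w \<in> W" "W \<subseteq> cvec.span B" and "w \<in> W"
  shows "w \<in> cvec.span (W \<inter> (\<Union>\<mu>. gen_eig f \<mu>))"
proof -
  have "(f ^^ i) w \<in> W" for i by (induction i) (use assms in auto)
  then have "(f ^^ i) w \<in> cvec.span B" for i using W(3) by (rule subsetD[rotated])
  from annihilating_poly_exists[OF \<open>finite B\<close> this]
  obtain p where "p \<noteq> 0" "peval f p w = 0" by (elim exE conjE)
  show ?thesis
    by (rule annihilated_in_span_gen_eig[where p = p]) (use W \<open>w \<in> W\<close> \<open>p \<noteq> 0\<close> \<open>peval f p w = 0\<close> in auto)
qed

end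

section \<open>Coordinates, matrices and the trace\<close>

definition coord :: "('n::finite \<Rightarrow> 'v::complex_vector) \<Rightarrow> 'v \<Rightarrow> complex ^ 'n"
  where "coord b v = (\<chi> i. cvec.representation (range b) v (b i))"

lemma vec_scaleC_nth [simp]: "(c *\<^sub>C v) $ i = c *\<^sub>C (v $ i)"
  by (simp add: scaleC_vec_def)

lemma scaleC_complex [simp]: "c *\<^sub>C (z::complex) = c * z"
  by (simp add: scaleC_complex_def)

context
  fixes b :: "'n::finite \<Rightarrow> 'v::complex_vector"
  assumes b: "is_basis b"
begin

lemma coord_sum: "(\<Sum>i\<in>UNIV. coord b v $ i *\<^sub>C b i) = v"
proof -
  have "(\<Sum>i\<in>UNIV. coord b v $ i *\<^sub>C b i)
      = (\<Sum>w\<in>range b. cvec.representation (range b) v w *\<^sub>C w)"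
    using b by (subst sum.reindex) (auto simp: is_basis_def coord_def)
  also have "\<dots> = v" using b by (intro cvec.sum_representation_eq) (auto simp: is_basis_def)
  finally show ?thesis .
qed

lemma clin_coord: "clin (coord b)"
  using b by (intro clinI)
    (auto simp: coord_def vec_eq_iff is_basis_def cvec.representation_add cvec.representation_scale)

lemma coord_basis: "coord b (b j) = axis j 1"
  using b by (auto simp: coord_def is_basis_def cvec.representation_basis vec_eq_iff axis_def inj_def)

lemma coord_nth_eq_0:
  assumes "v \<in> cvec.span (b ` I)" and "i \<notin> I"
  shows "coord b v $ i = 0"
  using assms(1)
proof (induction rule: cvec.span_induct_alt)
  case base
  then show ?case by (simp add: clin_zero[OF clin_coord])
next
  case (step c x y)
  then obtain j where "j \<in> I" "x = b j" by auto
  then have "coord b x $ i = 0" using assms(2) by (auto simp: coord_basis axis_def)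
  with step show ?case
    by (simp add: clin_add[OF clin_coord] clin_scale[OF clin_coord])
qed

end

context
  fixes b :: "'n::finite \<Rightarrow> 'v::complex_vector"
  assumes b: "is_basis b"
begin

lemma card_le_CARD_if_independent:
  assumes "cvec.independent (S :: 'v set)"
  shows "finite S \<and> card S \<le> CARD('n)"
  using cvec.independent_span_bound[of "range b" S] assms b
  by (auto simp: is_basis_def card_image)

lemma CARD_le_card_if_spanning:
  assumes "finite S" and "cvec.span S = (UNIV :: 'v set)"
  shows "CARD('n) \<le> card S"
  using cvec.independent_span_bound[of S "range b"] assms b
  by (auto simp: is_basis_def card_image)

text \<open>A basis of generalized eigenvectors in which \<open>f\<close> is triangular is built greedily: as long
  as the vectors found so far do not span, some generalized eigenvector lies outside their span;
  take the last of its iterates under \<open>f - \<mu>\<close> that is still outside.\<close>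

lemma triangular_basis_extend:
  assumes f: "clin (f :: 'v \<Rightarrow> 'v)" and S: "cvec.subspace S" "S \<noteq> UNIV"
  shows "\<exists>w \<mu>. w \<notin> S \<and> w \<in> gen_eig f \<mu> \<and> shift f \<mu> w \<in> S"
proof -
  have "\<not> (\<Union>\<mu>. gen_eig f \<mu>) \<subseteq> S"
  proof
    assume "(\<Union>\<mu>. gen_eig f \<mu>) \<subseteq> S"
    moreover have "v \<in> cvec.span (UNIV \<inter> (\<Union>\<mu>. gen_eig f \<mu>))" for v
      by (rule primary_decomposition[OF f, of "range b"]) (use b in \<open>auto simp: is_basis_def\<close>)
    ultimately have "v \<in> S" for v
      using span_in_subspace[OF _ S(1)] by (metis inf_top_left)
    with S show False by auto
  qed
  then obtain v \<mu> where v: "v \<in> gen_eig f \<mu>" "v \<notin> S" by auto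
  let ?s = "shift f \<mu>"
  obtain N where "(?s ^^ N) v = 0" using v by (auto simp: gen_eig_def)
  then have N: "(?s ^^ N) v \<in> S" using S by (simp add: cvec.subspace_0)
  define K where "K = (LEAST K. (?s ^^ K) v \<in> S)"
  have K: "(?s ^^ K) v \<in> S" unfolding K_def by (rule LeastI[of "\<lambda>K. (?s ^^ K) v \<in> S", OF N])
  then obtain J where J: "K = Suc J" using v by (cases K) auto
  have "(?s ^^ J) v \<notin> S"
    using not_less_Least[of J "\<lambda>K. (?s ^^ K) v \<in> S"] J by (simp add: K_def)
  moreover have "(?s ^^ J) v \<in> gen_eig f \<mu>"
    by (induction J) (use v gen_eig_shift[OF f] in auto)
  moreover have "?s ((?s ^^ J) v) \<in> S" using K J by simp
  ultimately show ?thesis by blast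
qed

lemma triangular_family:
  assumes f: "clin (f :: 'v \<Rightarrow> 'v)" and "k \<le> CARD('n)"
  shows "\<exists>w \<mu>. inj_on w {..<k} \<and> cvec.independent (w ` {..<k}) \<and>
    (\<forall>i<k. w i \<in> gen_eig f (\<mu> i) \<and> shift f (\<mu> i) (w i) \<in> cvec.span (w ` {..<i}))"
  using assms(2)
proof (induction k)
  case (Suc k)
  then obtain w \<mu> where w: "inj_on w {..<k}" "cvec.independent (w ` {..<k})"
    "\<And>i. i < k \<Longrightarrow> w i \<in> gen_eig f (\<mu> i)"
    "\<And>i. i < k \<Longrightarrow> shift f (\<mu> i) (w i) \<in> cvec.span (w ` {..<i})" by auto
  let ?S = "cvec.span (w ` {..<k})"
  have "?S \<noteq> UNIV"
    using CARD_le_card_if_spanning[of "w ` {..<k}"] Suc.prems card_image[OF w(1)] by auto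
  then obtain v \<nu> where v: "v \<notin> ?S" "v \<in> gen_eig f \<nu>" "shift f \<nu> v \<in> ?S"
    using triangular_basis_extend[OF f cvec.subspace_span] by blast
  let ?w = "w(k := v)" and ?\<mu> = "\<mu>(k := \<nu>)"
  have im: "?w ` {..<i} = w ` {..<i}" if "i \<le> k" for i using that by auto
  have imS: "?w ` {..<Suc k} = insert v (w ` {..<k})" by (auto simp: lessThan_Suc)
  have "v \<notin> w ` {..<k}" using v(1) cvec.span_superset[of "w ` {..<k}"] by auto
  then have "inj_on ?w {..<Suc k}"
    using w(1) by (auto simp: lessThan_Suc inj_on_def)
  moreover have "cvec.independent (?w ` {..<Suc k})"
    unfolding imS by (rule cvec.independent_insertI[OF v(1) w(2)])
  moreover have "?w i \<in> gen_eig f (?\<mu> i) \<and> shift f (?\<mu> i) (?w i) \<in> cvec.span (?w ` {..<i})"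
    if "i < Suc k" for i
    using that w v im[of i] by (cases "i = k") (auto simp: less_Suc_eq)
  ultimately show ?case by blast
qed (simp add: cvec.independent_empty)

text \<open>Of the triangular shape only the diagonal is kept, since that is what the trace sees.\<close>

lemma triangular_basis:
  assumes f: "clin (f :: 'v \<Rightarrow> 'v)"
  obtains e :: "'n \<Rightarrow> 'v" and \<mu> where "is_basis e" and "\<And>i. e i \<in> gen_eig f (\<mu> i)"
    and "\<And>i. coord e (f (e i)) $ i = \<mu> i"
proof -
  obtain w \<mu> where w: "inj_on w {..<CARD('n)}" "cvec.independent (w ` {..<CARD('n)})"
    "\<And>i. i < CARD('n) \<Longrightarrow> w i \<in> gen_eig f (\<mu> i)"
    "\<And>i. i < CARD('n) \<Longrightarrow> shift f (\<mu> i) (w i) \<in> cvec.span (w ` {..<i})"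
    using triangular_family[OF f order_refl] by auto
  obtain h where h: "bij_betw h (UNIV :: 'n set) {..<CARD('n)}"
    using ex_bij_betw_finite_nat[of "UNIV :: 'n set"] by (auto simp: atLeast0LessThan)
  define e where "e = (\<lambda>i. w (h i))"
  have hlt: "h i < CARD('n)" for i using h by (auto simp: bij_betw_def)
  have range: "range e = w ` {..<CARD('n)}" using h by (simp add: e_def bij_betw_def flip: image_image)
  have "cvec.span (range e) = UNIV"
  proof (rule ccontr)
    assume "cvec.span (range e) \<noteq> UNIV"
    then obtain v where v: "v \<notin> cvec.span (range e)" by auto
    then have "cvec.independent (insert v (range e))"
      using w(2) unfolding range by (intro cvec.independent_insertI)
    moreover have "v \<notin> range e" using v cvec.span_superset[of "range e"] by auto
    ultimately show False
      using card_le_CARD_if_independent[of "insert v (range e)"] card_image[OF w(1)]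
      by (simp add: range)
  qed
  moreover have "inj e"
    using comp_inj_on[of h UNIV w] w(1) h by (simp add: e_def bij_betw_def comp_def)
  ultimately have basis: "is_basis e" using w(2) by (simp add: is_basis_def range)
  moreover have "coord e (f (e i)) $ i = \<mu> (h i)" for i
  proof -
    have "w ` {..<h i} \<subseteq> e ` (UNIV - {i})"
    proof
      fix x assume "x \<in> w ` {..<h i}"
      then obtain m where m: "m < h i" "x = w m" by auto
      then have "m \<in> range h" using h hlt[of i] by (auto simp: bij_betw_def)
      then obtain j where "m = h j" by auto
      with m show "x \<in> e ` (UNIV - {i})" by (auto simp: e_def)
    qed
    then have "shift f (\<mu> (h i)) (e i) \<in> cvec.span (e ` (UNIV - {i}))"
      using w(4)[OF hlt[of i]] unfolding e_def by (auto dest: cvec.span_mono)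
    then have "coord e (shift f (\<mu> (h i)) (e i)) $ i = 0"
      by (rule coord_nth_eq_0[OF basis]) simp
    then show ?thesis
      by (simp add: shift_def clin_diff[OF clin_coord[OF basis]] clin_scale[OF clin_coord[OF basis]]
          coord_basis[OF basis])
  qed
  ultimately show ?thesis using that[of e "\<lambda>i. \<mu> (h i)"] w(3)[OF hlt] by (simp add: e_def)
qed

end

lemma is_basis_axis: "is_basis (\<lambda>i. axis i (1::complex) :: complex ^ 'n::finite)"
  unfolding is_basis_def
proof (intro conjI)
  have scale: "c *\<^sub>C (v :: complex ^ 'n) = c *s v" for c v by (simp add: vec_eq_iff)
  have expand: "(\<Sum>i\<in>UNIV. v $ i *\<^sub>C axis i 1) = v" for v :: "complex ^ 'n"
    using basis_expansion[of v] by (simp add: scale)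
  show inj: "inj (\<lambda>i. axis i (1::complex) :: complex ^ 'n)"
    by (auto simp: inj_def axis_eq_axis)
  have "v \<in> cvec.span (range (\<lambda>i. axis i 1))" for v :: "complex ^ 'n"
    by (subst expand[of v, symmetric]) (intro cvec.span_sum cvec.span_scale cvec.span_base rangeI)
  then show "cvec.span (range (\<lambda>i. axis i (1::complex) :: complex ^ 'n)) = UNIV" by auto
  show "cvec.independent (range (\<lambda>i. axis i (1::complex) :: complex ^ 'n))"
  proof (rule cvec.independent_if_scalars_zero)
    fix g :: "complex ^ 'n \<Rightarrow> complex" and x :: "complex ^ 'n"
    assume "(\<Sum>x\<in>range (\<lambda>i. axis i 1). g x *\<^sub>C x) = 0" and x: "x \<in> range (\<lambda>i. axis i 1)"
    then have "(\<Sum>i\<in>UNIV. g (axis i 1) *\<^sub>C (axis i 1 :: complex ^ 'n)) = 0"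
      by (subst (asm) sum.reindex[OF inj]) simp
    then have "(\<Sum>i\<in>UNIV. (\<chi> i. g (axis i 1)) $ i *\<^sub>C (axis i 1 :: complex ^ 'n)) = 0"
      by simp
    then have "(\<chi> i. g (axis i 1)) = (0 :: complex ^ 'n)" by (simp only: expand)
    with x show "g x = 0" by (auto simp: vec_eq_iff)
  qed simp
qed

lemma clin_matrix_vector: "clin ((*v) (X :: 'n::finite gl))"
  by (rule clinI)
    (simp_all add: vec_eq_iff matrix_vector_mult_def sum.distrib algebra_simps sum_distrib_left)

lemma matrix_eq_if_axis_eq:
  assumes "\<And>j. A *v axis j 1 = B *v axis j 1"
  shows "A = (B :: 'n::finite gl)"
  using assms
  by (auto simp: vec_eq_iff matrix_vector_mult_def axis_def if_distrib[of "\<lambda>x. _ * x"]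
      cong: if_cong)

lemma matrix_of_clin:
  assumes "clin f"
  obtains Y :: "'n::finite gl" where "\<And>v. Y *v v = f v"
proof
  let ?Y = "\<chi> i j. f (axis j 1) $ i"
  fix v :: "complex ^ 'n"
  have "?Y *v v = (\<Sum>j\<in>UNIV. v $ j *\<^sub>C f (axis j 1))"
    by (simp add: vec_eq_iff matrix_vector_mult_def sum_component mult.commute)
  also have "\<dots> = f (\<Sum>j\<in>UNIV. v $ j *\<^sub>C axis j 1)"
    by (simp add: clin_sum[OF assms] clin_scale[OF assms])
  also have "(\<Sum>j\<in>UNIV. v $ j *\<^sub>C axis j 1) = v"
    by (simp add: vec_eq_iff sum_component axis_def if_distrib[of "\<lambda>x. _ * x"] cong: if_cong)
  finally show "?Y *v v = f v" .
qed

lemma trace_eq_sum_coord: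
  fixes e :: "'n::finite \<Rightarrow> complex ^ 'n"
  assumes e: "is_basis e"
  shows "trace A = (\<Sum>i\<in>UNIV. coord e (A *v e i) $ i)"
proof -
  let ?c = "\<lambda>k i. coord e (A *v axis k 1) $ i"
  have "coord e (A *v e i) $ i = (\<Sum>k\<in>UNIV. e i $ k * ?c k i)" for i
  proof -
    have "A *v e i = (\<Sum>k\<in>UNIV. e i $ k *\<^sub>C (A *v axis k 1))"
      by (simp add: vec_eq_iff sum_component matrix_vector_mult_def axis_def mult.commute
          if_distrib[of "\<lambda>x. _ * x"] cong: if_cong)
    then show ?thesis
      by (simp add: clin_sum[OF clin_coord[OF e]] clin_scale[OF clin_coord[OF e]] sum_component)
  qed
  then have "(\<Sum>i\<in>UNIV. coord e (A *v e i) $ i) = (\<Sum>k\<in>UNIV. \<Sum>i\<in>UNIV. e i $ k * ?c k i)"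
    by (simp only:) (rule sum.swap)
  moreover have "(\<Sum>i\<in>UNIV. e i $ k * ?c k i) = A $ k $ k" for k
  proof -
    have "(\<Sum>i\<in>UNIV. e i $ k * ?c k i) = (\<Sum>i\<in>UNIV. ?c k i *\<^sub>C e i) $ k"
      by (simp add: sum_component mult.commute)
    also have "\<dots> = (A *v axis k 1) $ k" by (simp only: coord_sum[OF e])
    also have "\<dots> = A $ k $ k"
      by (simp add: matrix_vector_mult_def axis_def if_distrib[of "\<lambda>x. _ * x"] cong: if_cong)
    finally show ?thesis .
  qed
  ultimately show ?thesis by (simp add: trace_def)
qed

text \<open>For a semisimple \<open>X\<close> this \<open>Y\<close> is the complex conjugate of \<open>X\<close> in an eigenbasis. It makes
  \<open>trace (Y X)\<close> a sum of squared absolute values of eigenvalues, which vanishes only if \<open>X\<close> is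
  nilpotent. On the whole generalized eigenspace \<open>Y\<close> is scalar because the expansion of a
  generalized eigenvector in the basis only involves basis vectors of the same eigenvalue.\<close>

lemma conjugate_operator:
  fixes X :: "'n::finite gl"
  obtains Y :: "'n gl"
  where "\<And>\<mu> v. v \<in> gen_eig ((*v) X) \<mu> \<Longrightarrow> Y *v v = cnj \<mu> *\<^sub>C v"
    and "trace (Y ** X) = 0 \<Longrightarrow> gen_eig ((*v) X) 0 = UNIV"
proof -
  let ?f = "(*v) X"
  have f: "clin ?f" by (rule clin_matrix_vector)
  obtain e :: "'n \<Rightarrow> complex ^ 'n" and \<kappa> where e: "is_basis e"
    "\<And>i. e i \<in> gen_eig ?f (\<kappa> i)" "\<And>i. coord e (?f (e i)) $ i = \<kappa> i"
    using triangular_basis[OF is_basis_axis f] by blast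
  let ?y = "\<lambda>v. \<Sum>i\<in>UNIV. (cnj (\<kappa> i) * coord e v $ i) *\<^sub>C e i"
  have "clin ?y"
    by (rule clinI)
      (simp_all add: clin_add[OF clin_coord[OF e(1)]] clin_scale[OF clin_coord[OF e(1)]]
        cvec.scale_left_distrib distrib_left sum.distrib cvec.scale_sum_right mult.left_commute)
  then obtain Y :: "'n gl" where Y: "\<And>v. Y *v v = ?y v" by (rule matrix_of_clin) blast
  show thesis
  proof
    fix \<mu> v assume v: "v \<in> gen_eig ?f \<mu>"
    \<comment> \<open>Grouping the expansion of \<open>v\<close> by eigenvalue and subtracting \<open>v\<close> itself leaves a vanishing
      sum of generalized eigenvectors for distinct eigenvalues.\<close>
    let ?p = "\<lambda>\<nu>. \<Sum>i | \<kappa> i = \<nu>. coord e v $ i *\<^sub>C e i"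
    let ?F = "insert \<mu> (range \<kappa>)"
    let ?d = "\<lambda>\<nu>. ?p \<nu> - (if \<nu> = \<mu> then v else 0)"
    have group: "(\<Sum>\<nu>\<in>?F. \<Sum>i | \<kappa> i = \<nu>. g i) = (\<Sum>i\<in>UNIV. g i)" for g :: "'n \<Rightarrow> complex ^ 'n"
      using sum.group[of UNIV ?F \<kappa> g] by auto
    have "?d \<nu> = 0" if "\<nu> \<in> ?F" for \<nu>
    proof (rule gen_eig_independent[OF f _ _ _ that])
      show "?d \<nu> \<in> gen_eig ?f \<nu>" for \<nu>
        using e(2) v subspace_gen_eig[OF f, of \<nu>]
        by (auto intro!: cvec.subspace_diff cvec.subspace_sum cvec.subspace_scale
            simp: cvec.subspace_0)
      show "(\<Sum>\<nu>\<in>?F. ?d \<nu>) = 0"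
        by (simp only: sum_subtractf group coord_sum[OF e(1)]) simp
    qed simp
    then have d: "?p \<nu> = (if \<nu> = \<mu> then v else 0)" if "\<nu> \<in> ?F" for \<nu> using that by simp
    have "Y *v v = (\<Sum>\<nu>\<in>?F. \<Sum>i | \<kappa> i = \<nu>. (cnj (\<kappa> i) * coord e v $ i) *\<^sub>C e i)"
      by (simp only: Y group)
    also have "\<dots> = (\<Sum>\<nu>\<in>?F. cnj \<nu> *\<^sub>C ?p \<nu>)"
      by (intro sum.cong) (simp_all add: cvec.scale_sum_right scaleC_scaleC)
    also have "\<dots> = (\<Sum>\<nu>\<in>?F. if \<nu> = \<mu> then cnj \<mu> *\<^sub>C v else 0)"
      by (intro sum.cong) (simp_all add: d)
    also have "\<dots> = cnj \<mu> *\<^sub>C v" by simp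
    finally show "Y *v v = cnj \<mu> *\<^sub>C v" .
  next
    assume "trace (Y ** X) = 0"
    moreover have "coord e ((Y ** X) *v e i) $ i = of_real ((cmod (\<kappa> i))\<^sup>2)" for i
    proof -
      have "coord e ((Y ** X) *v e i) = coord e (?y (?f (e i)))"
        by (simp only: matrix_vector_mul_assoc[symmetric] Y)
      also have "\<dots> $ i = cnj (\<kappa> i) * \<kappa> i"
        by (simp add: clin_sum[OF clin_coord[OF e(1)]] clin_scale[OF clin_coord[OF e(1)]]
            coord_basis[OF e(1)] e(3) axis_def sum_component
            if_distrib[of "\<lambda>x. _ * x"] cong: if_cong)
      finally show ?thesis by (simp only: complex_norm_square mult.commute)
    qed
    ultimately have "of_real (\<Sum>i\<in>UNIV. (cmod (\<kappa> i))\<^sup>2) = (0 :: complex)"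
      by (simp add: trace_eq_sum_coord[OF e(1)])
    then have "\<kappa> i = 0" for i by (simp only: of_real_eq_0_iff) (simp add: sum_nonneg_eq_0_iff)
    then have "range e \<subseteq> gen_eig ?f 0" using e(2) by auto
    then have "v \<in> gen_eig ?f 0" for v
      using span_in_subspace[of v "range e", OF _ subspace_gen_eig[OF f]] e(1)
      by (auto simp: is_basis_def)
    then show "gen_eig ?f 0 = UNIV" by auto
  qed
qed

section \<open>The trace form of a perfect Lie algebra of matrices\<close>

lemma matrix_scaleC_left:
  "(c *\<^sub>C X) ** Y = c *\<^sub>C (X ** Y :: complex ^ 'n::finite ^ 'm::finite)"
  by (simp add: vec_eq_iff matrix_matrix_mult_def sum_distrib_left mult.assoc)

lemma matrix_scaleC_right:
  "X ** (c *\<^sub>C Y) = c *\<^sub>C (X ** Y :: complex ^ 'n::finite ^ 'm::finite)"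
  by (simp add: vec_eq_iff matrix_matrix_mult_def sum_distrib_left ac_simps)

lemma matrix_vector_scaleC_left:
  "(c *\<^sub>C X) *v v = c *\<^sub>C (X *v v :: complex ^ 'm::finite)"
  by (simp add: vec_eq_iff matrix_vector_mult_def sum_distrib_left mult.assoc)

lemma matrix_mult_add_left:
  "(X + Y) ** Z = X ** Z + (Y ** Z :: complex ^ 'n::finite ^ 'm::finite)"
  by (simp add: vec_eq_iff matrix_matrix_mult_def sum.distrib distrib_right)

lemma clin_matrix_mult_left: "clin ((**) (X :: 'n::finite gl) :: 'n gl \<Rightarrow> _)"
  by (rule clinI) (simp_all add: matrix_add_ldistrib matrix_scaleC_right)

lemma clin_matrix_mult_right: "clin (\<lambda>X :: 'n::finite gl. X ** (Y :: 'n gl))"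
  by (rule clinI) (simp_all add: matrix_mult_add_left matrix_scaleC_left)

lemma clin_trace: "clin (trace :: 'n::finite gl \<Rightarrow> complex)"
  by (rule clinI) (simp_all add: trace_def sum.distrib sum_distrib_left)

lemma clin_trace_mult: "clin (\<lambda>Y :: 'n::finite gl. trace ((X :: 'n gl) ** Y))"
  by (rule clinI) (simp_all add: clin_add[OF clin_matrix_mult_left] trace_add
      clin_scale[OF clin_matrix_mult_left] clin_scale[OF clin_trace])

lemma clin_commutator: "clin (commutator (X :: 'n::finite gl))"
  by (rule clinI) (simp_all add: commutator_def matrix_add_ldistrib matrix_mult_add_left
      matrix_scaleC_left matrix_scaleC_right cvec.scale_right_diff_distrib)

lemma matrix_expansion:
  "(\<Sum>i\<in>UNIV. \<Sum>j\<in>UNIV. X $ i $ j *\<^sub>C mat_unit i j) = (X :: 'n::finite gl)"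
proof -
  have "(\<Sum>i\<in>UNIV. \<Sum>j\<in>UNIV. X $ i $ j * (if k = i \<and> l = j then 1 else 0)) = X $ k $ l" for k l
  proof -
    have "(\<Sum>i\<in>UNIV. \<Sum>j\<in>UNIV. X $ i $ j * (if k = i \<and> l = j then 1 else 0))
      = (\<Sum>i\<in>UNIV. if k = i then (\<Sum>j\<in>UNIV. if l = j then X $ i $ j else 0) else 0)"
      by (intro sum.cong refl) (auto simp: if_distrib[of "\<lambda>x. _ * x"] cong: if_cong)
    also have "\<dots> = X $ k $ l" by simp
    finally show ?thesis .
  qed
  then show ?thesis by (simp add: vec_eq_iff sum_component mat_unit_def)
qed

definition mat_units :: "'n::finite gl set"
  where "mat_units = (\<lambda>(i, j). mat_unit i j) ` UNIV"

lemma finite_mat_units: "finite mat_units"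
  by (simp add: mat_units_def)

lemma span_mat_units: "cvec.span mat_units = (UNIV :: 'n::finite gl set)"
proof -
  have "X \<in> cvec.span mat_units" for X :: "'n gl"
    by (subst matrix_expansion[of X, symmetric])
      (intro cvec.span_sum cvec.span_scale cvec.span_base, auto simp: mat_units_def)
  then show ?thesis by auto
qed

text \<open>The induction on both exponents rests on the Leibniz rule
  \<open>(X - (\<mu> + \<nu>)) (b v) = ((ad X - \<mu>) b) v + b ((X - \<nu>) v)\<close>.\<close>

lemma gen_eig_commutator:
  fixes X :: "'n::finite gl"
  assumes "b \<in> gen_eig (commutator X) \<mu>" and "v \<in> gen_eig ((*v) X) \<nu>"
  shows "b *v v \<in> gen_eig ((*v) X) (\<mu> + \<nu>)" (is "_ \<in> ?G")
proof -
  let ?a = "shift (commutator X) \<mu>" and ?s = "shift ((*v) X) \<nu>"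
  note f = clin_matrix_vector[of X]
  have G: "cvec.subspace ?G" by (rule subspace_gen_eig[OF f])
  obtain p where "(?a ^^ p) b = 0" using assms by (auto simp: gen_eig_def)
  then show ?thesis using assms(2)
  proof (induction p arbitrary: b v)
    case 0
    then show ?case using cvec.subspace_0[OF G] by simp
  next
    case (Suc p)
    obtain q where "(?s ^^ q) v = 0" using Suc.prems by (auto simp: gen_eig_def)
    then show ?case using Suc.prems(2)
    proof (induction q arbitrary: v)
      case 0
      then show ?case using cvec.subspace_0[OF G] by simp
    next
      case (Suc q)
      have "(?a ^^ p) (?a b) = 0" using \<open>(?a ^^ Suc p) b = 0\<close> by (simp add: funpow_swap1)
      then have "?a b *v v \<in> ?G" using Suc.prems(2) by (rule \<open>\<And>b v. _ \<Longrightarrow> _ \<Longrightarrow> b *v v \<in> ?G\<close>)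
      moreover have "b *v ?s v \<in> ?G"
        using Suc.prems by (intro Suc.IH gen_eig_shift[OF f]) (simp_all add: funpow_swap1)
      moreover have "shift ((*v) X) (\<mu> + \<nu>) (b *v v) = ?a b *v v + b *v ?s v"
        by (simp add: shift_def commutator_def matrix_vector_mult_diff_rdistrib
            matrix_vector_mult_diff_distrib matrix_vector_mul_assoc matrix_vector_scaleC_left
            clin_scale[OF clin_matrix_vector] cvec.scale_left_distrib)
      ultimately show ?case
        by (subst gen_eig_step[OF f]) (simp_all add: cvec.subspace_add[OF G])
    qed
  qed
qed

lemma in_span_gen_eig:
  fixes X :: "'n::finite gl"
  fixes v :: "complex ^ 'n"
  shows "v \<in> cvec.span (\<Union>\<mu>. gen_eig ((*v) X) \<mu>)"
  using primary_decomposition[where f = "(*v) X" and B = "range (\<lambda>i. axis i 1)" and W = UNIV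
      and w = v, OF clin_matrix_vector] is_basis_axis[where 'n = 'n]
  by (simp add: is_basis_def)

text \<open>The derivation \<open>ad Y\<close> acts on the generalized eigenspace of \<open>ad X\<close> for \<open>\<mu>\<close> as the scalar
  \<open>cnj \<mu>\<close>: such a matrix raises eigenvalues of \<open>X\<close> by \<open>\<mu>\<close>, hence those of
  \<open>Y\<close> by \<open>cnj \<mu>\<close>. A subspace that \<open>ad X\<close> preserves is spanned by generalized eigenvectors, so
  \<open>ad Y\<close> preserves it too.\<close>

lemma conjugate_operator_stable:
  fixes X Y :: "'n::finite gl"
  assumes Y: "\<And>\<mu> v. v \<in> gen_eig ((*v) X) \<mu> \<Longrightarrow> Y *v v = cnj \<mu> *\<^sub>C v"
    and g: "cvec.subspace g" "\<And>b. b \<in> g \<Longrightarrow> commutator X b \<in> g" and "b \<in> g"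
  shows "commutator Y b \<in> g"
proof -
  have "commutator Y c = cnj \<mu> *\<^sub>C c" if c: "c \<in> gen_eig (commutator X) \<mu>" for c \<mu>
    unfolding matrix_eq matrix_vector_scaleC_left
  proof
    fix v
    show "commutator Y c *v v = cnj \<mu> *\<^sub>C (c *v v)"
    proof (rule clin_eq_on_span[OF clin_matrix_vector _ in_span_gen_eig[of v X]])
      show "clin (\<lambda>v. cnj \<mu> *\<^sub>C (c *v v))"
        by (rule clinI) (simp_all add: clin_add[OF clin_matrix_vector]
            clin_scale[OF clin_matrix_vector] cvec.scale_right_distrib mult.commute)
      fix s assume "s \<in> (\<Union>\<nu>. gen_eig ((*v) X) \<nu>)"
      then obtain \<nu> where s: "s \<in> gen_eig ((*v) X) \<nu>" by blast
      have "commutator Y c *v s = Y *v (c *v s) - c *v (Y *v s)"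
        by (simp add: commutator_def matrix_vector_mult_diff_rdistrib matrix_vector_mul_assoc)
      also have "\<dots> = cnj (\<mu> + \<nu>) *\<^sub>C (c *v s) - cnj \<nu> *\<^sub>C (c *v s)"
        by (simp only: Y[OF s] Y[OF gen_eig_commutator[OF c s]] clin_scale[OF clin_matrix_vector])
      finally show "commutator Y c *v s = cnj \<mu> *\<^sub>C (c *v s)"
        by (simp add: cvec.scale_left_distrib)
    qed
  qed
  then have *: "commutator Y s \<in> g" if "s \<in> g \<inter> (\<Union>\<mu>. gen_eig (commutator X) \<mu>)" for s
    using that g(1) by (auto intro: cvec.subspace_scale)
  have "b \<in> cvec.span (g \<inter> (\<Union>\<mu>. gen_eig (commutator X) \<mu>))"
    by (rule primary_decomposition[OF clin_commutator finite_mat_units g(1)])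
      (use g \<open>b \<in> g\<close> span_mat_units in auto)
  from clin_span_in_subspace[OF clin_commutator this g(1) *] show ?thesis .
qed

lemma trace_commutator_mult:
  "trace (Y ** commutator a b) = trace (commutator Y a ** (b :: 'n::finite gl))"
proof -
  have sub: "A ** (B - C) = A ** B - A ** C" "(B - C) ** A = B ** A - C ** A" for A B C :: "'n gl"
    by (simp_all add: clin_diff[OF clin_matrix_mult_left] clin_diff[OF clin_matrix_mult_right])
  have "trace (Y ** (b ** a)) = trace (a ** (Y ** b))"
    using trace_mul_sym[of a "Y ** b"] by (simp add: matrix_mul_assoc)
  then show ?thesis
    by (simp add: commutator_def sub trace_sub matrix_mul_assoc)
qed

text \<open>Cartan's argument: with \<open>Y\<close> the conjugate operator of \<open>X\<close> and \<open>X\<close> a sum of commutators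
  \<open>[a, b]\<close>, the trace of \<open>Y X\<close> is a sum of traces of \<open>[Y, a] b\<close>, and \<open>[Y, a]\<close> stays in \<open>g\<close>.\<close>

lemma trace_form_zero_imp_nilpotent:
  fixes g :: "'n::finite gl set"
  assumes g: "cvec.subspace g" "\<And>a b. a \<in> g \<Longrightarrow> b \<in> g \<Longrightarrow> commutator a b \<in> g"
    and perfect: "g \<subseteq> cvec.span {commutator a b | a b. a \<in> g \<and> b \<in> g}"
    and zero: "\<And>a b. a \<in> g \<Longrightarrow> b \<in> g \<Longrightarrow> trace (a ** b) = 0" and X: "X \<in> g"
  shows "gen_eig ((*v) X) 0 = UNIV"
proof -
  obtain Y where Y: "\<And>\<mu> v. v \<in> gen_eig ((*v) X) \<mu> \<Longrightarrow> Y *v v = cnj \<mu> *\<^sub>C v"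
    "trace (Y ** X) = 0 \<Longrightarrow> gen_eig ((*v) X) 0 = UNIV"
    using conjugate_operator[of X] by blast
  have "X \<in> cvec.span {commutator a b | a b. a \<in> g \<and> b \<in> g}" using X perfect by blast
  then have "trace (Y ** X) = 0"
  proof (induction rule: cvec.span_induct_alt)
    case base
    then show ?case by (simp add: trace_def)
  next
    case (step c x y)
    then obtain a b where ab: "x = commutator a b" "a \<in> g" "b \<in> g" by blast
    have "commutator Y a \<in> g"
      using conjugate_operator_stable[OF Y(1), where g = g and b = a] g X ab by auto
    then have "trace (Y ** x) = 0" using zero ab by (simp add: trace_commutator_mult)
    with step show ?case
      by (simp add: matrix_add_ldistrib matrix_scaleC_right trace_add clin_scale[OF clin_trace])
  qed
  then show ?thesis by (rule Y(2))
qed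

section \<open>Engel's theorem\<close>

context complex_lie_algebra
begin

lemma bracket_anti: "bracket x y = - bracket y x"
proof -
  have "bracket (x + y) (x + y) = bracket x y + bracket y x"
    by (simp only: clin_add[OF linear_bracket_left] clin_add[OF linear_bracket_right])
      (simp add: bracket_self)
  then show ?thesis by (simp add: bracket_self eq_neg_iff_add_eq_0)
qed

definition subalgebra :: "'l set \<Rightarrow> bool"
  where "subalgebra k \<longleftrightarrow> cvec.subspace k \<and> (\<forall>x\<in>k. \<forall>y\<in>k. bracket x y \<in> k)"

definition stable :: "('l \<Rightarrow> 'v \<Rightarrow> 'v::complex_vector) \<Rightarrow> 'l set \<Rightarrow> 'v set \<Rightarrow> bool"
  where "stable act k W \<longleftrightarrow> cvec.subspace W \<and> (\<forall>x\<in>k. \<forall>w\<in>W. act x w \<in> W)"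

text \<open>The conclusion of Engel's theorem for the quotient modules \<open>W / U\<close>, without forming
  quotients. Modules live on the type of the Lie algebra itself, so that the induction hypothesis
  can be applied to the adjoint action.\<close>

definition engel :: "'l set \<Rightarrow> bool"
  where "engel k \<longleftrightarrow> (\<forall>act :: 'l \<Rightarrow> 'l \<Rightarrow> 'l. \<forall>U W. lie_module bracket act \<longrightarrow>
    stable act k U \<longrightarrow> stable act k W \<longrightarrow> U \<subset> W \<longrightarrow> (\<forall>x\<in>k. \<forall>w. \<exists>N. (act x ^^ N) w = 0) \<longrightarrow>
    (\<exists>w\<in>W - U. \<forall>x\<in>k. act x w \<in> U))"

lemma engelD:
  assumes "engel k" and "lie_module bracket (act :: 'l \<Rightarrow> 'l \<Rightarrow> 'l)"
    and "stable act k U" and "stable act k W" and "U \<subset> W"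
    and "\<And>x w. x \<in> k \<Longrightarrow> \<exists>N. (act x ^^ N) w = 0"
  obtains w where "w \<in> W" and "w \<notin> U" and "\<And>x. x \<in> k \<Longrightarrow> act x w \<in> U"
  using assms unfolding engel_def by blast

text \<open>Adjoining to \<open>k\<close> one element \<open>x\<close> of its normalizer: the vectors of \<open>W\<close> that \<open>k\<close> sends
  into \<open>U\<close> are stable under \<open>x\<close>; for such a vector outside \<open>U\<close>, the last of its iterates under
  \<open>x\<close> that is still outside \<open>U\<close> is sent into \<open>U\<close> by \<open>x\<close> as well.\<close>

lemma engel_extend:
  assumes k: "subalgebra k" "engel k" and x: "\<And>y. y \<in> k \<Longrightarrow> bracket y x \<in> k"
  defines "k' \<equiv> {y + c *\<^sub>C x | y c. y \<in> k}"
  shows "subalgebra k'" and "engel k'"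
proof -
  have k0: "0 \<in> k" using k by (simp add: subalgebra_def cvec.subspace_0)
  have "0 + 1 *\<^sub>C x \<in> k'" unfolding k'_def using k0 by blast
  then have xx: "x \<in> k'" by (simp add: scaleC_one)
  have "y + 0 *\<^sub>C x \<in> k'" if "y \<in> k" for y unfolding k'_def using that by blast
  then have sub: "k \<subseteq> k'" by auto
  show "subalgebra k'"
    unfolding subalgebra_def cvec.subspace_def
  proof (intro conjI ballI allI)
    show "0 \<in> k'" using sub k0 by blast
    fix u assume "u \<in> k'"
    then obtain y c where u: "u = y + c *\<^sub>C x" "y \<in> k" by (auto simp: k'_def)
    show "d *\<^sub>C u \<in> k'" for d
    proof -
      have "d *\<^sub>C u = d *\<^sub>C y + (d * c) *\<^sub>C x" by (simp add: u cvec.scale_right_distrib)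
      moreover have "d *\<^sub>C y \<in> k" using u k by (simp add: subalgebra_def cvec.subspace_scale)
      ultimately show ?thesis unfolding k'_def by blast
    qed
    fix v assume "v \<in> k'"
    then obtain z d where v: "v = z + d *\<^sub>C x" "z \<in> k" by (auto simp: k'_def)
    have "u + v = (y + z) + (c + d) *\<^sub>C x" by (simp add: u v cvec.scale_left_distrib)
    moreover have "y + z \<in> k" using u v k by (simp add: subalgebra_def cvec.subspace_add)
    ultimately show "u + v \<in> k'" unfolding k'_def by blast
    have "bracket u v = bracket y z + d *\<^sub>C bracket y x + c *\<^sub>C bracket x z"
      by (simp add: u v clin_add[OF linear_bracket_left] clin_add[OF linear_bracket_right]
          clin_scale[OF linear_bracket_left] clin_scale[OF linear_bracket_right] bracket_self
          cvec.scale_right_distrib)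
    also have "\<dots> = bracket y z + d *\<^sub>C bracket y x - c *\<^sub>C bracket z x"
      by (subst bracket_anti[of x z]) simp
    also have "\<dots> \<in> k" using k(1) x u v
      by (auto simp: subalgebra_def intro!: cvec.subspace_add cvec.subspace_diff cvec.subspace_scale)
    finally show "bracket u v \<in> k'" using sub by blast
  qed
  show "engel k'"
    unfolding engel_def
  proof (intro allI impI)
    fix act :: "'l \<Rightarrow> 'l \<Rightarrow> 'l" and U W
    assume mod: "lie_module bracket act" and U: "stable act k' U" and W: "stable act k' W"
      and UW: "U \<subset> W" and nil: "\<forall>x\<in>k'. \<forall>w. \<exists>N. (act x ^^ N) w = 0"
    interpret lie_module bracket act by (rule mod)
    have Us: "cvec.subspace U" using U by (auto simp: stable_def)
    have Ux: "act y u \<in> U" if "y \<in> k'" "u \<in> U" for y u using U that by (auto simp: stable_def)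
    have Wx: "act y w \<in> W" if "y \<in> k'" "w \<in> W" for y w using W that by (auto simp: stable_def)
    have "stable act k U" "stable act k W" using U W sub by (auto simp: stable_def)
    then obtain w where w: "w \<in> W" "w \<notin> U" "\<And>y. y \<in> k \<Longrightarrow> act y w \<in> U"
      using engelD[OF k(2) mod _ _ UW] nil sub by blast
    define P where "P v \<longleftrightarrow> v \<in> W \<and> (\<forall>y\<in>k. act y v \<in> U)" for v
    have Px: "P (act x v)" if "P v" for v
      unfolding P_def
    proof (intro conjI ballI)
      show "act x v \<in> W" using that xx Wx by (simp add: P_def)
      fix y assume y: "y \<in> k"
      have "act y (act x v) = act (bracket y x) v + act x (act y v)"
        by (simp add: act_bracket)
      also have "\<dots> \<in> U" using that y x xx Ux Us by (auto simp: P_def intro!: cvec.subspace_add)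
      finally show "act y (act x v) \<in> U" .
    qed
    obtain N where "(act x ^^ N) w = 0" using nil xx by blast
    then have N: "(act x ^^ N) w \<in> U" using Us by (simp add: cvec.subspace_0)
    define K where "K = (LEAST K. (act x ^^ K) w \<in> U)"
    have K: "(act x ^^ K) w \<in> U"
      unfolding K_def by (rule LeastI[of "\<lambda>K. (act x ^^ K) w \<in> U", OF N])
    then obtain J where J: "K = Suc J" using w by (cases K) auto
    let ?v = "(act x ^^ J) w"
    have v: "?v \<notin> U" using not_less_Least[of J "\<lambda>K. (act x ^^ K) w \<in> U"] J by (simp add: K_def)
    have "P ?v" by (induction J) (use w Px in \<open>auto simp: P_def\<close>)
    moreover have "act x ?v \<in> U" using K J by simp
    ultimately have "act u ?v \<in> U" if "u \<in> k'" for u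
      using that Us by (auto simp: k'_def P_def clin_add[OF linear_act_left]
          clin_scale[OF linear_act_left] intro!: cvec.subspace_add cvec.subspace_scale)
    with \<open>P ?v\<close> v show "\<exists>w\<in>W - U. \<forall>x\<in>k'. act x w \<in> U" unfolding P_def by blast
  qed
qed

lemma lie_module_adjoint: "lie_module bracket bracket"
proof unfold_locales
  show "bracket (bracket x y) v = bracket x (bracket y v) - bracket y (bracket x v)" for x y v
  proof -
    have "bracket (bracket x y) v = - bracket v (bracket x y)" by (rule bracket_anti)
    moreover have "bracket y (bracket v x) = - bracket y (bracket x v)"
      by (subst bracket_anti[of v x]) (simp add: clin_minus[OF linear_bracket_right])
    ultimately show ?thesis using jacobi[of x y v]
      by (simp add: add_eq_0_iff2 algebra_simps)
  qed
qed (simp_all add: clin_add[OF linear_bracket_right] clin_add[OF linear_bracket_left]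
    clin_scale[OF linear_bracket_right] clin_scale[OF linear_bracket_left])

text \<open>The induction starts from the zero subalgebra. Engel's theorem for a proper subalgebra
  \<open>k\<close> of \<open>h\<close>, applied to the adjoint action of \<open>k\<close> on \<open>h / k\<close>, yields an element of \<open>h - k\<close>
  that normalizes \<open>k\<close> and can be adjoined. The number of independent vectors in \<open>k\<close> grows, so
  finite dimension bounds the number of steps.\<close>

theorem engel_nilpotent:
  assumes h: "subalgebra h" and fin: "finite B" "h \<subseteq> cvec.span B"
    and nil: "\<And>x y. x \<in> h \<Longrightarrow> \<exists>N. (bracket x ^^ N) y = 0"
  shows "engel h"
proof -
  have "\<exists>k. subalgebra k \<and> k \<subseteq> h \<and> engel k \<and>
    (k = h \<or> (\<exists>S. S \<subseteq> k \<and> finite S \<and> card S = n \<and> cvec.independent S))" for n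
  proof (induction n)
    case 0
    have "subalgebra {0}"
      by (auto simp: subalgebra_def cvec.subspace_def clin_zero[OF linear_bracket_right])
    moreover have "engel {0}"
      unfolding engel_def
    proof (intro allI impI)
      fix act :: "'l \<Rightarrow> 'l \<Rightarrow> 'l" and U W
      assume mod: "lie_module bracket act" and U: "stable act {0} U" and UW: "U \<subset> W"
      interpret lie_module bracket act by (rule mod)
      have "act 0 w \<in> U" for w
        using U by (simp add: clin_zero[OF linear_act_left] stable_def cvec.subspace_0)
      with UW show "\<exists>w\<in>W - U. \<forall>x\<in>{0}. act x w \<in> U" by auto
    qed
    moreover have "0 \<in> h" using h by (simp add: subalgebra_def cvec.subspace_0)
    ultimately show ?case
      by (intro exI[of _ "{0}"]) (auto intro!: exI[of _ "{}"] simp: cvec.independent_empty)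
  next
    case (Suc n)
    then obtain k where k: "subalgebra k" "k \<subseteq> h" "engel k"
      and alt: "k = h \<or> (\<exists>S. S \<subseteq> k \<and> finite S \<and> card S = n \<and> cvec.independent S)" by blast
    show ?case
    proof (cases "k = h")
      case True
      then show ?thesis using k by blast
    next
      case False
      with alt obtain S where S: "S \<subseteq> k" "finite S" "card S = n" "cvec.independent S" by blast
      have "stable bracket k k" "stable bracket k h"
        using k h by (auto simp: stable_def subalgebra_def)
      then obtain x where x: "x \<in> h" "x \<notin> k" "\<And>y. y \<in> k \<Longrightarrow> bracket y x \<in> k"
        using engelD[OF k(3) lie_module_adjoint, of k h] k(2) nil False by blast
      let ?k = "{y + c *\<^sub>C x | y c. y \<in> k}"
      have kk: "subalgebra ?k" "engel ?k" using engel_extend[OF k(1,3) x(3)] by auto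
      have "?k \<subseteq> h" using k x h
        by (auto simp: subalgebra_def intro!: cvec.subspace_add cvec.subspace_scale)
      moreover have "insert x S \<subseteq> ?k"
      proof -
        have "x = 0 + 1 *\<^sub>C x" "0 \<in> k" using k by (auto simp: subalgebra_def cvec.subspace_0 scaleC_one)
        moreover have "y = y + 0 *\<^sub>C x" for y by simp
        ultimately show ?thesis using S(1) by blast
      qed
      moreover have "cvec.span S \<subseteq> k"
        using S(1) k(1) by (simp add: subalgebra_def cvec.span_minimal)
      then have "cvec.independent (insert x S)"
        using x S by (intro cvec.independent_insertI) auto
      moreover have "x \<notin> S" using S(1) x(2) by blast
      then have "card (insert x S) = Suc n" "finite (insert x S)" using S by auto
      ultimately show ?thesis using kk by blast
    qed
  qed
  from this[of "Suc (card B)"] obtain k where k: "k \<subseteq> h" "engel k"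
    and alt: "k = h \<or> (\<exists>S. S \<subseteq> k \<and> finite S \<and> card S = Suc (card B) \<and> cvec.independent S)" by blast
  have False if "S \<subseteq> k" "card S = Suc (card B)" "cvec.independent S" for S
    using cvec.independent_span_bound[OF fin(1) that(3)] fin(2) k(1) that by auto
  with alt k show ?thesis by blast
qed

end

section \<open>Lie algebras of nilpotent matrices\<close>

lemma complex_lie_algebra_commutator:
  "complex_lie_algebra (commutator :: 'n::finite gl \<Rightarrow> 'n gl \<Rightarrow> 'n gl)"
proof
  show "commutator x (commutator y z) + commutator y (commutator z x)
      + commutator z (commutator x y) = 0" for x y z :: "'n gl"
    by (simp add: commutator_def clin_diff[OF clin_matrix_mult_left]
        clin_diff[OF clin_matrix_mult_right] matrix_mul_assoc)
qed (simp_all add: commutator_def clin_add[OF clin_matrix_mult_left]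
    clin_add[OF clin_matrix_mult_right] clin_scale[OF clin_matrix_mult_left]
    clin_scale[OF clin_matrix_mult_right] cvec.scale_right_diff_distrib)

interpretation gl: complex_lie_algebra "commutator :: 'n::finite gl \<Rightarrow> 'n gl \<Rightarrow> 'n gl"
  by (rule complex_lie_algebra_commutator)

lemma lie_module_matrix_mult:
  "lie_module (commutator :: 'n::finite gl \<Rightarrow> 'n gl \<Rightarrow> 'n gl) ((**) :: 'n gl \<Rightarrow> 'n gl \<Rightarrow> 'n gl)"
proof (intro lie_module.intro complex_lie_algebra_commutator lie_module_axioms.intro
    clin_matrix_mult_left clin_matrix_mult_right)
  show "commutator X Y ** Z = X ** (Y ** Z) - Y ** (X ** Z)" for X Y Z :: "'n gl"
    by (simp add: commutator_def clin_diff[OF clin_matrix_mult_right] matrix_mul_assoc)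
qed

text \<open>For a nilpotent \<open>X\<close> all of \<open>\<complex>\<^sup>n\<close> is the generalized eigenspace of \<open>0\<close>, so a matrix
  that maps it into the generalized eigenspace of \<open>\<mu> \<noteq> 0\<close> has to vanish. This serves to show that
  both \<open>ad X\<close> and left multiplication by \<open>X\<close> are nilpotent.\<close>

lemma nilpotent_transfer:
  fixes X :: "'n::finite gl"
  assumes f: "clin f" and X: "gen_eig ((*v) X) 0 = UNIV"
    and shifts: "\<And>\<mu> c v. c \<in> gen_eig f \<mu> \<Longrightarrow> c *v v \<in> gen_eig ((*v) X) \<mu>"
  shows "\<exists>N. (f ^^ N) (Y :: 'n gl) = 0"
proof -
  have "c \<in> gen_eig f 0" if c: "c \<in> gen_eig f \<mu>" for c \<mu>
  proof (cases "\<mu> = 0")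
    case False
    have "c *v v = 0" for v
      by (rule gen_eig_disjoint[OF clin_matrix_vector shifts[OF c] _ False]) (simp add: X)
    then have "c = 0" using matrix_eq[of c 0] by simp
    then show ?thesis using cvec.subspace_0[OF subspace_gen_eig[OF f]] by simp
  qed (use c in simp)
  moreover have "Y \<in> cvec.span (UNIV \<inter> (\<Union>\<mu>. gen_eig f \<mu>))"
    by (rule primary_decomposition[OF f finite_mat_units]) (simp_all add: span_mat_units)
  ultimately have "Y \<in> gen_eig f 0"
    by (intro span_in_subspace[OF _ subspace_gen_eig[OF f]]) auto
  moreover have "shift f 0 = f" by (simp add: shift_def fun_eq_iff)
  ultimately show ?thesis by (simp add: gen_eig_def)
qed

lemma gen_eig_matrix_mult:
  fixes X :: "'n::finite gl"
  assumes "c \<in> gen_eig ((**) X) \<mu>"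
  shows "c *v v \<in> gen_eig ((*v) X) \<mu>"
proof -
  have "(shift ((**) X) \<mu> ^^ N) c *v v = (shift ((*v) X) \<mu> ^^ N) (c *v v)" for N
    by (induction N)
      (simp_all add: shift_def matrix_vector_mult_diff_rdistrib matrix_vector_scaleC_left
        flip: matrix_vector_mul_assoc)
  moreover obtain N where "(shift ((**) X) \<mu> ^^ N) c = 0" using assms by (auto simp: gen_eig_def)
  ultimately have "(shift ((*v) X) \<mu> ^^ N) (c *v v) = 0" by (metis matrix_vector_mult_0)
  then show ?thesis by (auto simp: gen_eig_def)
qed

text \<open>Engel's theorem is applied to the action of \<open>g\<close> on matrices by left multiplication; it
  provides a non-zero matrix \<open>w\<close> with \<open>X w = 0\<close> for all \<open>X\<close> in \<open>g\<close>, whose image is killed by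
  \<open>g\<close>.\<close>

lemma common_null_vector:
  fixes g :: "'n::finite gl set"
  assumes g: "gl.subalgebra g" and nil: "\<And>X. X \<in> g \<Longrightarrow> gen_eig ((*v) X) 0 = UNIV"
  obtains u :: "complex ^ 'n" where "u \<noteq> 0" and "\<And>X. X \<in> g \<Longrightarrow> X *v u = 0"
proof -
  have engel: "gl.engel g"
  proof (rule gl.engel_nilpotent[OF g finite_mat_units])
    show "\<exists>N. (commutator X ^^ N) Y = 0" if "X \<in> g" for X Y
      using nilpotent_transfer[OF clin_commutator nil[OF that]] nil[OF that]
        gen_eig_commutator[of _ X _ _ 0] by auto
  qed (simp add: span_mat_units)
  have stable: "gl.stable (**) g {0}" "gl.stable (**) g UNIV"
    by (auto simp: gl.stable_def cvec.subspace_def clin_zero[OF clin_matrix_mult_left])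
  have null: "\<exists>N. ((**) X ^^ N) W = 0" if "X \<in> g" for X W :: "'n gl"
    by (rule nilpotent_transfer[OF clin_matrix_mult_left nil[OF that]])
      (rule gen_eig_matrix_mult)
  have proper: "{0 :: 'n gl} \<subset> UNIV"
  proof -
    have "mat 1 $ i $ i \<noteq> (0 :: 'n gl) $ i $ i" for i by (simp add: mat_def)
    then have "mat 1 \<noteq> (0 :: 'n gl)" by metis
    then show ?thesis by blast
  qed
  have "\<exists>w :: 'n gl. w \<noteq> 0 \<and> (\<forall>X\<in>g. X ** w = 0)"
  proof (rule gl.engelD[OF engel lie_module_matrix_mult stable proper null])
    fix w :: "'n gl"
    assume "w \<notin> {0}" and "\<And>X. X \<in> g \<Longrightarrow> X ** w \<in> {0}"
    then have "w \<noteq> 0 \<and> (\<forall>X\<in>g. X ** w = 0)" by simp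
    then show ?thesis by (rule exI)
  qed
  then obtain w :: "'n gl" where w: "w \<noteq> 0" "\<And>X. X \<in> g \<Longrightarrow> X ** w = 0" by blast
  have "\<exists>v. w *v v \<noteq> 0" using w(1) matrix_eq[of w 0] by simp
  then obtain v where "w *v v \<noteq> 0" by (elim exE)
  moreover have "X *v (w *v v) = 0" if "X \<in> g" for X
    using w(2)[OF that] by (simp add: matrix_vector_mul_assoc)
  ultimately show thesis by (rule that)
qed

section \<open>Irreducible representations of simple Lie algebras\<close>

lemma (in simple_lie_algebra) perfect: "cvec.span {bracket x y | x y. True} = UNIV"
proof -
  have "lie_ideal (cvec.span {bracket x y | x y. True})"
    unfolding lie_ideal_def by (auto intro: cvec.span_base)
  moreover have "cvec.span {bracket x y | x y. True} \<noteq> {0}"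
  proof -
    obtain x y where "bracket x y \<noteq> 0" using non_abelian by blast
    moreover have "bracket x y \<in> cvec.span {bracket x y | x y. True}"
      by (rule cvec.span_base) blast
    ultimately show ?thesis by blast
  qed
  ultimately show ?thesis using simple by blast
qed

context lie_module
begin

context
  fixes b :: "'n::finite \<Rightarrow> 'v"
  assumes b: "is_basis b"
begin

lemma coord_act: "coord b (act x v) = rep_matrix b act x *v coord b v"
proof -
  have "coord b (act x v) = coord b (act x (\<Sum>j\<in>UNIV. coord b v $ j *\<^sub>C b j))"
    by (simp only: coord_sum[OF b])
  also have "\<dots> = (\<Sum>j\<in>UNIV. coord b v $ j *\<^sub>C coord b (act x (b j)))"
    by (simp add: clin_sum[OF linear_act] clin_scale[OF linear_act] clin_sum[OF clin_coord[OF b]]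
        clin_scale[OF clin_coord[OF b]])
  also have "\<dots> = rep_matrix b act x *v coord b v"
    by (simp add: vec_eq_iff sum_component matrix_vector_mult_def rep_matrix_def coord_def
        mult.commute)
  finally show ?thesis .
qed

lemma rep_matrix_axis: "rep_matrix b act x *v axis j 1 = coord b (act x (b j))"
  by (simp add: coord_act coord_basis[OF b])

lemma clin_rep_matrix: "clin (rep_matrix b act)"
  by (rule clinI; rule matrix_eq_if_axis_eq)
    (simp_all add: rep_matrix_axis matrix_vector_mult_add_rdistrib matrix_vector_scaleC_left
      clin_add[OF linear_act_left] clin_scale[OF linear_act_left]
      clin_add[OF clin_coord[OF b]] clin_scale[OF clin_coord[OF b]])

lemma rep_matrix_bracket:
  "rep_matrix b act (bracket x y) = commutator (rep_matrix b act x) (rep_matrix b act y)"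
  by (rule matrix_eq_if_axis_eq)
    (simp add: commutator_def matrix_vector_mult_diff_rdistrib rep_matrix_axis act_bracket
      clin_diff[OF clin_coord[OF b]] coord_act flip: matrix_vector_mul_assoc)

lemma subspace_range_rep_matrix: "cvec.subspace (range (rep_matrix b act))"
  unfolding cvec.subspace_def
proof (intro conjI ballI allI)
  show "0 \<in> range (rep_matrix b act)" by (metis clin_zero[OF clin_rep_matrix] rangeI)
  show "X + Y \<in> range (rep_matrix b act)"
    if "X \<in> range (rep_matrix b act)" "Y \<in> range (rep_matrix b act)" for X Y
    using that by (auto simp flip: clin_add[OF clin_rep_matrix])
  show "c *\<^sub>C X \<in> range (rep_matrix b act)" if "X \<in> range (rep_matrix b act)" for c X
    using that by (auto simp flip: clin_scale[OF clin_rep_matrix])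
qed

lemma commutator_in_range_rep_matrix:
  "X \<in> range (rep_matrix b act) \<Longrightarrow> Y \<in> range (rep_matrix b act) \<Longrightarrow>
    commutator X Y \<in> range (rep_matrix b act)"
  by (auto simp flip: rep_matrix_bracket)

end

end

locale simple_irreducible_representation =
  simple_lie_algebra bracket + irreducible_lie_module bracket act
  for bracket :: "'l::complex_vector \<Rightarrow> 'l \<Rightarrow> 'l"
    and act :: "'l \<Rightarrow> 'v::complex_vector \<Rightarrow> 'v" +
  fixes b :: "'n::finite \<Rightarrow> 'v"
  assumes nontrivial: "\<exists>x v. act x v \<noteq> 0" and basis: "is_basis b"
begin

abbreviation \<rho> :: "'l \<Rightarrow> 'n gl"
  where "\<rho> \<equiv> rep_matrix b act"

lemmas clin_\<rho> = clin_rep_matrix[OF basis]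
lemmas \<rho>_bracket = rep_matrix_bracket[OF basis]

lemma \<rho>_in_span_commutators:
  "\<rho> x \<in> cvec.span {commutator X Y | X Y. X \<in> range \<rho> \<and> Y \<in> range \<rho>}" (is "_ \<in> cvec.span ?C")
proof (rule clin_span_in_subspace[OF clin_\<rho> _ cvec.subspace_span])
  show "x \<in> cvec.span {bracket x y | x y. True}" by (simp only: perfect UNIV_I)
  fix s assume "s \<in> {bracket x y | x y. True}"
  then obtain x y where "s = bracket x y" by blast
  then have "\<rho> s \<in> ?C" using \<rho>_bracket by blast
  then show "\<rho> s \<in> cvec.span ?C" by (rule cvec.span_base)
qed

lemma range_\<rho>_subset_sl: "range \<rho> \<subseteq> sl"
proof
  fix X assume "X \<in> range \<rho>"
  then have "X \<in> cvec.span {commutator X Y | X Y. X \<in> range \<rho> \<and> Y \<in> range \<rho>}"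
    using \<rho>_in_span_commutators by auto
  then show "X \<in> sl"
  proof (rule span_in_subspace)
    show "cvec.subspace (sl :: 'n gl set)"
      by (auto simp: sl_def cvec.subspace_def clin_zero[OF clin_trace] trace_add
          clin_scale[OF clin_trace])
    show "{commutator X Y | X Y. X \<in> range \<rho> \<and> Y \<in> range \<rho>} \<subseteq> sl"
      by (auto simp: sl_def commutator_def trace_sub) (rule trace_mul_sym)
  qed
qed

text \<open>The vectors killed by \<open>L\<close> form a submodule, which is proper because the action is
  non-trivial.\<close>

lemma no_common_null_vector:
  assumes "\<And>x. \<rho> x *v u = 0"
  shows "u = 0"
proof -
  define v where "v = (\<Sum>i\<in>UNIV. u $ i *\<^sub>C b i)"
  have "coord b v = (\<Sum>i\<in>UNIV. u $ i *\<^sub>C axis i 1)"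
    by (simp add: v_def clin_sum[OF clin_coord[OF basis]] clin_scale[OF clin_coord[OF basis]]
        coord_basis[OF basis])
  also have "\<dots> = u"
    by (simp add: vec_eq_iff sum_component axis_def if_distrib[of "\<lambda>x. _ * x"] cong: if_cong)
  finally have u: "coord b v = u" .
  have zero: "w = 0" if "coord b w = 0" for w
    using coord_sum[OF basis, of w] that by simp
  have "act x v = 0" for x
    by (rule zero) (simp add: coord_act[OF basis] u assms)
  moreover have "submodule {v. \<forall>x. act x v = 0}"
    by (auto simp: submodule_def cvec.subspace_def clin_zero[OF linear_act]
        clin_add[OF linear_act] clin_scale[OF linear_act])
  then have "{v. \<forall>x. act x v = 0} = {0}" using irreducible nontrivial by blast
  ultimately have "v = 0" by blast
  then show ?thesis using u by (simp add: clin_zero[OF clin_coord[OF basis]] flip: u)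
qed

text \<open>The radical of the trace form pulls back to an ideal of \<open>L\<close>. If it were all of \<open>L\<close>, then
  by Cartan's argument every \<open>\<rho> x\<close> would be nilpotent, and Engel's theorem would produce a
  vector killed by \<open>L\<close>.\<close>

theorem trace_form_nondegenerate:
  assumes "X \<in> range \<rho>" and "\<And>Y. Y \<in> range \<rho> \<Longrightarrow> trace (X ** Y) = 0"
  shows "X = 0"
proof -
  let ?rad = "{x. \<forall>y. trace (\<rho> x ** \<rho> y) = 0}"
  have "lie_ideal ?rad"
    unfolding lie_ideal_def
  proof (intro conjI allI ballI)
    show "cvec.subspace ?rad"
      by (auto simp: cvec.subspace_def clin_zero[OF clin_\<rho>] clin_add[OF clin_\<rho>]
          clin_scale[OF clin_\<rho>] matrix_mult_add_left matrix_scaleC_left trace_add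
          clin_scale[OF clin_trace] clin_zero[OF clin_matrix_mult_right] clin_zero[OF clin_trace])
    fix x y assume y: "y \<in> ?rad"
    have "trace (\<rho> (bracket x y) ** \<rho> z) = - trace (\<rho> y ** \<rho> (bracket x z))" for z
    proof -
      have "\<rho> (bracket x y) = - commutator (\<rho> y) (\<rho> x)"
        by (simp add: \<rho>_bracket commutator_def)
      then show ?thesis
        by (simp add: \<rho>_bracket trace_commutator_mult clin_minus[OF clin_matrix_mult_right]
            clin_minus[OF clin_trace])
    qed
    with y show "bracket x y \<in> ?rad" by simp
  qed
  then have "?rad = {0} \<or> ?rad = UNIV" by (rule simple)
  then show ?thesis
  proof
    assume rad: "?rad = {0}"
    obtain x where x: "X = \<rho> x" using assms(1) by blast
    then have "x \<in> ?rad" using assms(2) by simp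
    then show ?thesis using rad x by (simp add: clin_zero[OF clin_\<rho>])
  next
    assume rad: "?rad = UNIV"
    have "gen_eig ((*v) Z) 0 = UNIV" if "Z \<in> range \<rho>" for Z
    proof (rule trace_form_zero_imp_nilpotent[OF subspace_range_rep_matrix[OF basis]])
      show "range \<rho> \<subseteq> cvec.span {commutator a b | a b. a \<in> range \<rho> \<and> b \<in> range \<rho>}"
        using \<rho>_in_span_commutators by blast
      show "trace (a ** b) = 0" if "a \<in> range \<rho>" "b \<in> range \<rho>" for a b
        using that rad by blast
    qed (use that commutator_in_range_rep_matrix[OF basis] in auto)
    moreover have "gl.subalgebra (range \<rho>)"
      using subspace_range_rep_matrix[OF basis] commutator_in_range_rep_matrix[OF basis]
      by (simp add: gl.subalgebra_def)
    ultimately obtain u where "u \<noteq> 0" "\<And>Z. Z \<in> range \<rho> \<Longrightarrow> Z *v u = 0"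
      using common_null_vector[of "range \<rho>"] by blast
    with no_common_null_vector[of u] show ?thesis by blast
  qed
qed

end

section \<open>Linear maps on tensor products\<close>

lemma clin_compose: "clin f \<Longrightarrow> clin g \<Longrightarrow> clin (\<lambda>x. f (g x))"
  by (rule clinI) (simp_all add: clin_add clin_scale)

lemma tensor_eqI: "p - q \<in> tensor_relations \<Longrightarrow> tensor_eq p q"
  unfolding tensor_eq_def by (rule cvec.span_base)

lemma clin_tensor_left: "clin (\<lambda>x. x \<otimes>\<^sub>C y)"
proof (rule clinI)
  show "(x + x') \<otimes>\<^sub>C y = x \<otimes>\<^sub>C y + x' \<otimes>\<^sub>C y" for x x'
    by transfer (rule tensor_eqI, unfold tensor_relations_def Let_def diff_diff_eq, blast)
  show "(c *\<^sub>C x) \<otimes>\<^sub>C y = c *\<^sub>C (x \<otimes>\<^sub>C y)" for c x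
    by transfer (rule tensor_eqI, unfold tensor_relations_def Let_def, blast)
qed

lemma clin_tensor_right: "clin (\<lambda>y. x \<otimes>\<^sub>C y)"
proof (rule clinI)
  show "x \<otimes>\<^sub>C (y + y') = x \<otimes>\<^sub>C y + x \<otimes>\<^sub>C y'" for y y'
    by transfer (rule tensor_eqI, unfold tensor_relations_def Let_def diff_diff_eq, blast)
  show "x \<otimes>\<^sub>C (c *\<^sub>C y) = c *\<^sub>C (x \<otimes>\<^sub>C y)" for c y
    by transfer (rule tensor_eqI, unfold tensor_relations_def Let_def, blast)
qed

definition free_extension ::
    "('a \<Rightarrow> 'b \<Rightarrow> 'c::complex_vector) \<Rightarrow> ('a \<times> 'b \<Rightarrow>\<^sub>0 complex) \<Rightarrow> 'c"
  where "free_extension \<beta> p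
    = (\<Sum>k\<in>Poly_Mapping.keys p. Poly_Mapping.lookup p k *\<^sub>C case_prod \<beta> k)"

lemma free_extension_superset:
  "finite S \<Longrightarrow> Poly_Mapping.keys p \<subseteq> S \<Longrightarrow>
    free_extension \<beta> p = (\<Sum>k\<in>S. Poly_Mapping.lookup p k *\<^sub>C case_prod \<beta> k)"
  unfolding free_extension_def by (rule sum.mono_neutral_left) (auto simp: in_keys_iff)

lemma clin_free_extension: "clin (free_extension \<beta>)"
proof (rule clinI)
  fix p q :: "'a \<times> 'b \<Rightarrow>\<^sub>0 complex"
  let ?S = "Poly_Mapping.keys p \<union> Poly_Mapping.keys q"
  have "free_extension \<beta> r = (\<Sum>k\<in>?S. Poly_Mapping.lookup r k *\<^sub>C case_prod \<beta> k)"
    if "r \<in> {p, q, p + q}" for r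
    by (rule free_extension_superset) (use that keys_add[of p q] in auto)
  then show "free_extension \<beta> (p + q) = free_extension \<beta> p + free_extension \<beta> q"
    by (simp add: lookup_add cvec.scale_left_distrib sum.distrib)
next
  fix c and p :: "'a \<times> 'b \<Rightarrow>\<^sub>0 complex"
  have "free_extension \<beta> (c *\<^sub>C p) = (\<Sum>k\<in>Poly_Mapping.keys p. Poly_Mapping.lookup (c *\<^sub>C p) k *\<^sub>C case_prod \<beta> k)"
    by (rule free_extension_superset) (auto simp: in_keys_iff scaleC_poly_mapping.rep_eq)
  then show "free_extension \<beta> (c *\<^sub>C p) = c *\<^sub>C free_extension \<beta> p"
    by (simp add: free_extension_def scaleC_poly_mapping.rep_eq cvec.scale_sum_right)
qed

lemma free_extension_single: "free_extension \<beta> (Poly_Mapping.single (x, y) 1) = \<beta> x y"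
  by (simp add: free_extension_def scaleC_one)

text \<open>The universal property of the tensor product: by bilinearity the linear extension of \<open>\<beta>\<close> to
  the free vector space kills the defining relations.\<close>

lemma bilinear_factors_through_tensor:
  fixes \<beta> :: "'a::complex_vector \<Rightarrow> 'b::complex_vector \<Rightarrow> 'c::complex_vector"
  assumes left: "\<And>y. clin (\<lambda>x. \<beta> x y)" and right: "\<And>x. clin (\<beta> x)"
  obtains h where "clin h" and "\<And>x y. h (x \<otimes>\<^sub>C y) = \<beta> x y"
proof -
  let ?f = "free_extension \<beta>"
  note f = clin_free_extension[of \<beta>]
  have "?f r = 0" if "r \<in> cvec.span tensor_relations" for r
  proof (rule clin_eq_on_span[OF f _ that, of "\<lambda>_. 0"])
    show "clin (\<lambda>_. 0)" by (rule clinI) simp_all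
    show "?f s = 0" if "s \<in> tensor_relations" for s
      using that
      by (auto simp: tensor_relations_def Let_def clin_diff[OF f] clin_scale[OF f]
          free_extension_single clin_add[OF left] clin_add[OF right] clin_scale[OF left]
          clin_scale[OF right])
  qed
  then have resp: "?f p = ?f q" if "tensor_eq p q" for p q
    using that unfolding tensor_eq_def by (metis clin_diff[OF f] eq_iff_diff_eq_0)
  define h where "h t = ?f (rep_tensor t)" for t
  have abs: "abs_tensor (rep_tensor t) = t" for t :: "('a, 'b) tensor"
    by (rule Quotient_abs_rep[OF Quotient_tensor])
  have h: "h (abs_tensor p) = ?f p" for p
    unfolding h_def by (rule resp) (simp only: abs flip: tensor.abs_eq_iff)
  show thesis
  proof
    show "clin h"
    proof (rule clinI)
      show "h (t + u) = h t + h u" for t u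
        by (metis abs plus_tensor.abs_eq h clin_add[OF f])
      show "h (c *\<^sub>C t) = c *\<^sub>C h t" for c t
        by (metis abs scaleC_tensor.abs_eq h clin_scale[OF f])
    qed
    show "h (x \<otimes>\<^sub>C y) = \<beta> x y" for x y
      by (simp add: tensor.abs_eq h free_extension_single)
  qed
qed

text \<open>As \<^const>\<open>tensor_lift\<close> is a choice among linear maps with prescribed values on \<open>S\<close> and \<open>T\<close>,
  one has to see that such a map exists; a bilinear map \<open>\<gamma>\<close> with these values, defined
  everywhere, yields one.\<close>

lemma tensor_lift:
  assumes left: "\<And>y. clin (\<lambda>x. \<gamma> x y)" and right: "\<And>x. clin (\<gamma> x)"
    and agree: "\<And>x y. x \<in> S \<Longrightarrow> y \<in> T \<Longrightarrow> \<gamma> x y = \<beta> x y"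
  shows "clin (tensor_lift S T \<beta>)"
    and "x \<in> S \<Longrightarrow> y \<in> T \<Longrightarrow> tensor_lift S T \<beta> (x \<otimes>\<^sub>C y) = \<beta> x y"
proof -
  obtain h where "clin h" "\<And>x y. h (x \<otimes>\<^sub>C y) = \<gamma> x y"
    using bilinear_factors_through_tensor[of \<gamma>] left right by metis
  then have "\<exists>h. clin h \<and> (\<forall>x\<in>S. \<forall>y\<in>T. h (x \<otimes>\<^sub>C y) = \<beta> x y)"
    using agree by auto
  from someI_ex[OF this]
  show "clin (tensor_lift S T \<beta>)"
    and "x \<in> S \<Longrightarrow> y \<in> T \<Longrightarrow> tensor_lift S T \<beta> (x \<otimes>\<^sub>C y) = \<beta> x y"
    by (auto simp: tensor_lift_def)
qed

lemma tensor_in_tensor_space: "x \<in> S \<Longrightarrow> y \<in> T \<Longrightarrow> x \<otimes>\<^sub>C y \<in> tensor_space S T"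
  unfolding tensor_space_def by (rule cvec.span_base) blast

lemma subspace_tensor_space: "cvec.subspace (tensor_space S T)"
  unfolding tensor_space_def by (rule cvec.subspace_span)

section \<open>The maps \<open>B\<close>, \<open>\<eta>\<close> and \<open>\<delta>\<close>\<close>

lemma B_map_nth: "B_map f $ k $ l = f (mat_unit l k)"
proof -
  have "B_map f = (\<Sum>j\<in>UNIV. \<Sum>i\<in>UNIV. f (mat_unit i j) *\<^sub>C mat_unit j i)"
    unfolding B_map_def by (rule sum.swap)
  also have "\<dots> = (\<chi> j i. f (mat_unit i j))"
    using matrix_expansion[of "\<chi> j i. f (mat_unit i j)"] by simp
  finally show ?thesis by simp
qed

lemma trace_mat_unit_mult: "trace (mat_unit i j ** X) = X $ j $ (i :: 'n::finite)"
proof -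
  have "(mat_unit i j ** X) $ k $ k = (if k = i then X $ j $ k else 0)" for k
    by (auto simp: matrix_matrix_mult_def mat_unit_def if_distrib[of "\<lambda>x. x * _"] cong: if_cong)
  then show ?thesis by (simp add: trace_def)
qed

lemma trace_mat_unit: "trace (mat_unit i (j :: 'n::finite)) = (if i = j then 1 else 0 :: complex)"
  by (cases "i = j") (auto simp: trace_def mat_unit_def intro: sum.neutral)

text \<open>Thus \<open>B\<close> is inverse to \<open>X \<mapsto> trace (X \<cdot>)\<close>, which identifies \<open>B\<^sup>-\<^sup>1\<close>.\<close>

lemma functional_eq_trace:
  assumes "clin f" shows "f Y = trace (B_map f ** Y)"
proof (rule clin_eq_on_span[OF assms, of "\<lambda>Y. trace (B_map f ** Y)" Y mat_units])
  show "clin (\<lambda>Y. trace (B_map f ** Y))" by (rule clin_trace_mult)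
  show "Y \<in> cvec.span mat_units" by (simp add: span_mat_units)
  fix s :: "'a gl" assume "s \<in> mat_units"
  then obtain i j where s: "s = mat_unit i j" by (auto simp: mat_units_def)
  have "trace (B_map f ** s) = trace (s ** B_map f)" by (rule trace_mul_sym)
  then show "f s = trace (B_map f ** s)" by (simp add: s trace_mat_unit_mult B_map_nth)
qed

lemma trace_mult_in_sl_dual: "X \<in> sl \<Longrightarrow> (\<lambda>Y. trace (X ** Y)) \<in> sl_dual"
  by (simp add: sl_dual_def sl_def clin_trace_mult)

lemma B_inv_eq:
  fixes X :: "'n::finite gl"
  assumes "X \<in> sl"
  shows "B_inv X = (\<lambda>Y. trace (X ** Y))"
  unfolding B_inv_def
proof (rule inv_into_f_eq)
  show "inj_on B_map (sl_dual :: ('n gl \<Rightarrow> complex) set)"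
  proof (rule inj_onI)
    fix f g :: "'n gl \<Rightarrow> complex"
    assume f: "f \<in> sl_dual" and g: "g \<in> sl_dual" and eq: "B_map f = B_map g"
    have "clin f" "clin g" using f g by (simp_all add: sl_dual_def)
    then show "f = g"
      using functional_eq_trace[of f] functional_eq_trace[of g] eq by (simp add: fun_eq_iff)
  qed
  show "(\<lambda>Y. trace (X ** Y)) \<in> sl_dual" using assms by (rule trace_mult_in_sl_dual)
  have "trace (X ** mat_unit l k) = X $ k $ l" for k l
    using trace_mul_sym[of X "mat_unit l k"] by (simp add: trace_mat_unit_mult)
  then show "B_map (\<lambda>Y. trace (X ** Y)) = X" by (simp add: vec_eq_iff B_map_nth)
qed

lemma fun_scaleC_apply [simp]: "(c *\<^sub>C f) x = c *\<^sub>C f x"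
  by (simp add: scaleC_fun_def)

lemma clin_\<eta>: "clin (\<eta> :: ('n::finite gl, _) tensor \<Rightarrow> _)"
  and \<eta>_tensor: "x \<in> sl \<Longrightarrow> f \<in> sl_dual \<Longrightarrow> \<eta> (x \<otimes>\<^sub>C f) = (\<lambda>y :: 'n::finite gl. f y *\<^sub>C x)"
proof -
  have left: "clin (\<lambda>x y. f y *\<^sub>C (x :: 'n gl))" for f :: "'n gl \<Rightarrow> complex"
    by (rule clinI) (simp_all add: fun_eq_iff cvec.scale_right_distrib mult.commute)
  have right: "clin (\<lambda>f y. f y *\<^sub>C (x :: 'n gl))" for x :: "'n gl"
    by (rule clinI) (simp_all add: fun_eq_iff cvec.scale_left_distrib)
  note lift = tensor_lift[of "\<lambda>x f y. f y *\<^sub>C (x :: 'n gl)" sl sl_dual, OF left right refl]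
  show "clin (\<eta> :: ('n gl, _) tensor \<Rightarrow> _)"
    unfolding \<eta>_def by (rule lift(1))
  show "x \<in> sl \<Longrightarrow> f \<in> sl_dual \<Longrightarrow> \<eta> (x \<otimes>\<^sub>C f) = (\<lambda>y :: 'n gl. f y *\<^sub>C x)"
    unfolding \<eta>_def by (rule lift(2))
qed

lemma clin_tensor_map_B_inv:
  "clin (tensor_map sl sl id B_inv :: ('n::finite gl, 'n gl) tensor \<Rightarrow> _)"
  and tensor_map_B_inv: "(x :: 'n gl) \<in> sl \<Longrightarrow> y \<in> sl \<Longrightarrow>
    tensor_map sl sl id B_inv (x \<otimes>\<^sub>C y) = x \<otimes>\<^sub>C (\<lambda>z :: 'n::finite gl. trace (y ** z))"
proof -
  have right: "clin (\<lambda>y. x \<otimes>\<^sub>C (\<lambda>z :: 'n gl. trace (y ** z)))" for x :: "'n gl"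
  proof -
    have "clin (\<lambda>y (z :: 'n gl). trace (y ** z))"
      by (rule clinI) (auto simp: fun_eq_iff matrix_mult_add_left trace_add matrix_scaleC_left
          clin_scale[OF clin_trace])
    from clin_compose[OF clin_tensor_right this] show ?thesis .
  qed
  note lift = tensor_lift[of "\<lambda>x y. (x :: 'n gl) \<otimes>\<^sub>C (\<lambda>z :: 'n gl. trace (y ** z))" sl sl
      "\<lambda>x y. id x \<otimes>\<^sub>C B_inv y", OF clin_tensor_left right]
  show "clin (tensor_map sl sl id B_inv :: ('n gl, 'n gl) tensor \<Rightarrow> _)"
    unfolding tensor_map_def by (rule lift(1)) (simp add: B_inv_eq)
  show "tensor_map sl sl id B_inv (x \<otimes>\<^sub>C y) = x \<otimes>\<^sub>C (\<lambda>z :: 'n gl. trace (y ** z))"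
    if "x \<in> sl" "y \<in> sl" for x y :: "'n gl"
  proof -
    have "tensor_map sl sl id B_inv (x \<otimes>\<^sub>C y) = id x \<otimes>\<^sub>C B_inv y"
      unfolding tensor_map_def by (rule lift(2)) (simp_all add: B_inv_eq that)
    then show ?thesis using that by (simp add: B_inv_eq)
  qed
qed

text \<open>Replacing every matrix \<open>x\<close> in the formula for \<open>\<delta>\<close> by its traceless part
  \<open>x - (trace x / n) I\<close> does not change the value: the correction terms are tensors with one
  factor \<open>I\<close>, and those coming from the two halves of the antisymmetrization cancel.\<close>

lemma antisymmetrized_in_sl:
  "(\<Sum>k\<in>UNIV. mat_unit i k \<otimes>\<^sub>C mat_unit k j - mat_unit k j \<otimes>\<^sub>C mat_unit i k)
    \<in> tensor_space sl (sl :: 'n::finite gl set)"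
proof -
  let ?I = "mat 1 :: 'n gl"
  define a where "a = 1 / (of_nat CARD('n) :: complex)"
  define q where "q x = x - (a * trace x) *\<^sub>C ?I" for x :: "'n gl"
  let ?E = "\<lambda>k. mat_unit i k :: 'n gl" and ?F = "\<lambda>k. mat_unit k j :: 'n gl"
  have "trace (a *\<^sub>C ?I) = 1"
    by (simp add: clin_scale[OF clin_trace] trace_I a_def)
  then have q: "q x \<in> sl" for x
    using clin_scale[OF clin_trace, of "trace x" "a *\<^sub>C ?I"]
    by (simp add: q_def sl_def trace_sub scaleC_scaleC mult.commute)
  have expand: "x \<otimes>\<^sub>C y = q x \<otimes>\<^sub>C q y + (a * trace y) *\<^sub>C (x \<otimes>\<^sub>C ?I) + (a * trace x) *\<^sub>C (?I \<otimes>\<^sub>C y)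
      - (a * trace x * (a * trace y)) *\<^sub>C (?I \<otimes>\<^sub>C ?I)" for x y
    by (simp add: q_def clin_diff[OF clin_tensor_left] clin_diff[OF clin_tensor_right]
        clin_scale[OF clin_tensor_left] clin_scale[OF clin_tensor_right]
        cvec.scale_right_diff_distrib mult.commute)
  have "?E k \<otimes>\<^sub>C ?F k - ?F k \<otimes>\<^sub>C ?E k = q (?E k) \<otimes>\<^sub>C q (?F k) - q (?F k) \<otimes>\<^sub>C q (?E k)
      + a *\<^sub>C ((trace (?F k) *\<^sub>C ?E k - trace (?E k) *\<^sub>C ?F k) \<otimes>\<^sub>C ?I)
      + a *\<^sub>C (?I \<otimes>\<^sub>C (trace (?E k) *\<^sub>C ?F k - trace (?F k) *\<^sub>C ?E k))" for k
    by (subst (1 2) expand) (simp add: clin_diff[OF clin_tensor_left] clin_diff[OF clin_tensor_right]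
        clin_scale[OF clin_tensor_left] clin_scale[OF clin_tensor_right]
        cvec.scale_right_diff_distrib mult.commute algebra_simps)
  then have "(\<Sum>k\<in>UNIV. ?E k \<otimes>\<^sub>C ?F k - ?F k \<otimes>\<^sub>C ?E k)
      = (\<Sum>k\<in>UNIV. q (?E k) \<otimes>\<^sub>C q (?F k) - q (?F k) \<otimes>\<^sub>C q (?E k))
      + a *\<^sub>C ((\<Sum>k\<in>UNIV. trace (?F k) *\<^sub>C ?E k - trace (?E k) *\<^sub>C ?F k) \<otimes>\<^sub>C ?I)
      + a *\<^sub>C (?I \<otimes>\<^sub>C (\<Sum>k\<in>UNIV. trace (?E k) *\<^sub>C ?F k - trace (?F k) *\<^sub>C ?E k))"
    by (simp only: sum.distrib cvec.scale_sum_right clin_sum[OF clin_tensor_left]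
        clin_sum[OF clin_tensor_right])
  moreover have "(\<Sum>k\<in>UNIV. trace (?F k) *\<^sub>C ?E k) = mat_unit i j"
    "(\<Sum>k\<in>UNIV. trace (?E k) *\<^sub>C ?F k) = mat_unit i j"
    by (simp_all add: trace_mat_unit if_distrib[of "\<lambda>c. c *\<^sub>C _"] scaleC_one cong: if_cong)
  ultimately have "(\<Sum>k\<in>UNIV. ?E k \<otimes>\<^sub>C ?F k - ?F k \<otimes>\<^sub>C ?E k)
      = (\<Sum>k\<in>UNIV. q (?E k) \<otimes>\<^sub>C q (?F k) - q (?F k) \<otimes>\<^sub>C q (?E k))"
    by (simp add: sum_subtractf clin_zero[OF clin_tensor_left] clin_zero[OF clin_tensor_right])
  also have "\<dots> \<in> tensor_space sl sl"
    by (intro cvec.subspace_sum cvec.subspace_diff subspace_tensor_space tensor_in_tensor_space q)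
  finally show ?thesis .
qed

lemma \<delta>_in_sl: "\<delta> X \<in> tensor_space sl sl"
  unfolding \<delta>_def
  by (intro cvec.subspace_sum cvec.subspace_scale subspace_tensor_space antisymmetrized_in_sl)

section \<open>Orthogonal projection onto the image\<close>

locale nondegenerate_matrix_lie_algebra =
  fixes R :: "'n::finite gl set"
  assumes subspace: "cvec.subspace R" and traceless: "R \<subseteq> sl"
    and commutator_closed: "X \<in> R \<Longrightarrow> Y \<in> R \<Longrightarrow> commutator X Y \<in> R"
    and nondegenerate: "X \<in> R \<Longrightarrow> (\<And>Y. Y \<in> R \<Longrightarrow> trace (X ** Y) = 0) \<Longrightarrow> X = 0"
begin

lemma orth_eq: "orth R = {M \<in> sl. \<forall>Y\<in>R. trace (M ** Y) = 0}"
  by (auto simp: orth_def form_B_def B_inv_eq)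

text \<open>The functionals \<open>trace (r \<cdot>)\<close> with \<open>r\<close> in \<open>R\<close> exhaust the dual of \<open>R\<close>: restricted to a
  basis of \<open>R\<close> they are, by non-degeneracy, as many independent functions as the basis has
  elements.\<close>

lemma trace_functional_represented: "\<exists>r\<in>R. \<forall>Y\<in>R. trace (r ** Y) = trace (Z ** Y)"
proof -
  obtain S where S: "S \<subseteq> R" "cvec.independent S" "R \<subseteq> cvec.span S"
    using cvec.maximal_independent_subset[of R] by metis
  have fin: "finite S"
    using cvec.independent_span_bound[OF finite_mat_units S(2)] by (simp add: span_mat_units)
  define \<Phi> where "\<Phi> W = (\<lambda>Y. if Y \<in> S then trace (W ** Y) else 0)" for W :: "'n gl"
  have \<Phi>: "clin \<Phi>"
    by (rule clinI) (auto simp: \<Phi>_def fun_eq_iff matrix_mult_add_left trace_add matrix_scaleC_left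
        clin_scale[OF clin_trace])
  have extend: "trace (W ** Y) = 0" if "\<Phi> W = 0" "Y \<in> R" for W Y
  proof (rule clin_eq_on_span[OF clin_trace_mult, of "\<lambda>_. 0" Y S])
    show "clin (\<lambda>_ :: 'n gl. 0 :: complex)" by (rule clinI) simp_all
    show "Y \<in> cvec.span S" using that S by blast
    show "trace (W ** s) = 0" if "s \<in> S" for s
      using fun_cong[OF \<open>\<Phi> W = 0\<close>, of s] that by (simp add: \<Phi>_def)
  qed
  interpret \<Phi>: module_hom scaleC scaleC \<Phi> using \<Phi> by (simp add: Vector_Spaces.linear_def)
  have span: "cvec.span S = R" using S subspace cvec.span_minimal by blast
  have inj: "inj_on \<Phi> R"
  proof (rule inj_onI)
    fix X Y assume XY: "X \<in> R" "Y \<in> R" "\<Phi> X = \<Phi> Y"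
    then have "\<Phi> (X - Y) = 0" by (simp add: clin_diff[OF \<Phi>])
    moreover have "X - Y \<in> R" using XY subspace by (simp add: cvec.subspace_diff)
    ultimately have "X - Y = 0" using nondegenerate extend by blast
    then show "X = Y" by simp
  qed
  then have ind: "cvec.independent (\<Phi> ` S)"
    using S(2) by (intro \<Phi>.independent_injective_image) (simp_all add: span)
  have card: "card (\<Phi> ` S) = card S"
    using inj S(1) by (intro card_image) (rule inj_on_subset)
  \<comment> \<open>All functions \<open>\<Phi> W\<close> lie in the span of the indicator functions of the elements of \<open>S\<close>, which
    bounds the number of independent ones.\<close>
  let ?E = "(\<lambda>e Y. if Y = e then 1 else 0 :: complex) ` S"
  have in_E: "\<Phi> W \<in> cvec.span ?E" for W
  proof -
    have "\<Phi> W = (\<Sum>e\<in>S. trace (W ** e) *\<^sub>C (\<lambda>Y. if Y = e then 1 else 0))"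
    proof
      fix Y
      have "(\<Sum>e\<in>S. trace (W ** e) *\<^sub>C (\<lambda>Y. if Y = e then 1 else 0)) Y
          = (\<Sum>e\<in>S. if Y = e then trace (W ** e) else 0)"
        using fin by (induction S rule: finite_induct) auto
      then show "\<Phi> W Y = (\<Sum>e\<in>S. trace (W ** e) *\<^sub>C (\<lambda>Y. if Y = e then 1 else 0)) Y"
        using fin by (simp add: \<Phi>_def)
    qed
    then show ?thesis
      by (simp only:) (intro cvec.span_sum cvec.span_scale cvec.span_base imageI)
  qed
  have "\<Phi> Z \<in> cvec.span (\<Phi> ` S)"
  proof (rule ccontr)
    assume not: "\<Phi> Z \<notin> cvec.span (\<Phi> ` S)"
    have "card (insert (\<Phi> Z) (\<Phi> ` S)) \<le> card ?E"
      using cvec.independent_span_bound[of ?E "insert (\<Phi> Z) (\<Phi> ` S)"] fin in_E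
        cvec.independent_insertI[OF not ind] by blast
    moreover have "\<Phi> Z \<notin> \<Phi> ` S" using not cvec.span_superset[of "\<Phi> ` S"] by auto
    ultimately have "Suc (card S) \<le> card ?E" using fin by (simp add: card)
    then show False using card_image_le[OF fin, of "\<lambda>e Y. if Y = e then 1 else 0 :: complex"] by simp
  qed
  then have "\<Phi> Z \<in> \<Phi> ` R" by (simp add: \<Phi>.span_image span)
  then obtain r where r: "r \<in> R" "\<Phi> r = \<Phi> Z" by auto
  have "trace (r ** Y) = trace (Z ** Y)" if "Y \<in> R" for Y
    using extend[of "r - Z" Y] r(2) that
    by (simp add: clin_diff[OF \<Phi>] clin_diff[OF clin_matrix_mult_right] trace_sub)
  with r show ?thesis by blast
qed

definition proj :: "'n gl \<Rightarrow> 'n gl"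
  where "proj Z = (SOME r. r \<in> R \<and> (\<forall>Y\<in>R. trace (r ** Y) = trace (Z ** Y)))"

lemma proj_in: "proj Z \<in> R"
  and trace_proj: "Y \<in> R \<Longrightarrow> trace (proj Z ** Y) = trace (Z ** Y)"
  using someI_ex[of "\<lambda>r. r \<in> R \<and> (\<forall>Y\<in>R. trace (r ** Y) = trace (Z ** Y))"]
    trace_functional_represented[of Z] unfolding proj_def by blast+

lemma proj_unique:
  assumes "r \<in> R" and "\<And>Y. Y \<in> R \<Longrightarrow> trace (r ** Y) = trace (Z ** Y)"
  shows "proj Z = r"
proof -
  have "proj Z - r = 0"
    by (rule nondegenerate) (use assms proj_in subspace in \<open>auto simp: trace_proj
        clin_diff[OF clin_matrix_mult_right] trace_sub cvec.subspace_diff\<close>)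
  then show ?thesis by simp
qed

lemma clin_proj: "clin proj"
proof (rule clinI; rule proj_unique)
  show "proj X + proj Y \<in> R" "c *\<^sub>C proj X \<in> R" for c X Y
    using proj_in subspace by (simp_all add: cvec.subspace_add cvec.subspace_scale)
  show "trace ((proj X + proj Y) ** Z) = trace ((X + Y) ** Z)" if "Z \<in> R" for X Y Z
    using that by (simp add: matrix_mult_add_left trace_add trace_proj)
  show "trace ((c *\<^sub>C proj X) ** Z) = trace ((c *\<^sub>C X) ** Z)" if "Z \<in> R" for c X Z
    using that by (simp add: matrix_scaleC_left clin_scale[OF clin_trace] trace_proj)
qed

lemma proj_id: "r \<in> R \<Longrightarrow> proj r = r"
  by (rule proj_unique) auto

lemma proj_orth: "m \<in> orth R \<Longrightarrow> proj m = 0"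
  by (rule proj_unique) (auto simp: orth_eq cvec.subspace_0[OF subspace]
      clin_zero[OF clin_matrix_mult_right] clin_zero[OF clin_trace])

lemma orth_part: "Z \<in> sl \<Longrightarrow> Z - proj Z \<in> orth R"
  using proj_in[of Z] traceless
  by (auto simp: orth_eq sl_def trace_sub clin_diff[OF clin_matrix_mult_right] trace_proj)

lemma proj_along_eq:
  assumes "Z \<in> sl" shows "proj_along R (orth R) Z = proj Z"
proof -
  have "\<exists>p. clin p \<and> (\<forall>u\<in>R. p u = u) \<and> (\<forall>w\<in>orth R. p w = 0)"
    using clin_proj proj_id proj_orth by blast
  from someI_ex[OF this] have p: "clin (proj_along R (orth R))"
    "\<And>u. u \<in> R \<Longrightarrow> proj_along R (orth R) u = u"
    "\<And>w. w \<in> orth R \<Longrightarrow> proj_along R (orth R) w = 0"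
    unfolding proj_along_def by auto
  have "proj_along R (orth R) Z = proj_along R (orth R) (proj Z + (Z - proj Z))" by simp
  also have "\<dots> = proj Z"
    by (simp only: clin_add[OF p(1)] p(2)[OF proj_in] p(3)[OF orth_part[OF assms]]) simp
  finally show ?thesis .
qed

text \<open>The map \<open>proj \<otimes> proj\<close> meets the specification of \<^const>\<open>Proj\<close>, so the choice in its definition
  is not void. The specification determines the values on \<open>sl \<otimes> sl\<close>, as \<open>sl\<close> is the sum of \<open>R\<close>
  and its complement.\<close>

lemma clin_Proj: "clin (Proj R)"
  and Proj_tensor: "x \<in> sl \<Longrightarrow> y \<in> sl \<Longrightarrow> Proj R (x \<otimes>\<^sub>C y) = proj x \<otimes>\<^sub>C proj y"
proof -
  let ?O = "orth R"
  let ?W = "{a + b + c | a b c. a \<in> tensor_space R ?O \<and> b \<in> tensor_space ?O R \<and> c \<in> tensor_space ?O ?O}"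
  obtain h where h: "clin h" "\<And>x y. h (x \<otimes>\<^sub>C y) = proj x \<otimes>\<^sub>C proj y"
    using bilinear_factors_through_tensor[of "\<lambda>x y. proj x \<otimes>\<^sub>C proj y"]
      clin_compose[OF clin_tensor_left clin_proj] clin_compose[OF clin_tensor_right clin_proj]
    by blast
  have zero: "h t = 0" if "t \<in> tensor_space S T" and
    "\<And>x y. x \<in> S \<Longrightarrow> y \<in> T \<Longrightarrow> proj x = 0 \<or> proj y = 0" for t S T
  proof (rule clin_eq_on_span[OF h(1), of "\<lambda>_. 0"])
    show "clin (\<lambda>_ :: ('n gl, 'n gl) tensor. 0 :: ('n gl, 'n gl) tensor)" by (rule clinI) simp_all
    show "t \<in> cvec.span {x \<otimes>\<^sub>C y | x y. x \<in> S \<and> y \<in> T}"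
      using that(1) by (simp add: tensor_space_def)
    show "h s = 0" if "s \<in> {x \<otimes>\<^sub>C y | x y. x \<in> S \<and> y \<in> T}" for s
    proof -
      from that obtain x y where s: "s = x \<otimes>\<^sub>C y" "x \<in> S" "y \<in> T" by blast
      then have "proj x = 0 \<or> proj y = 0" using \<open>\<And>x y. x \<in> S \<Longrightarrow> y \<in> T \<Longrightarrow> _\<close> by blast
      then show ?thesis
        by (auto simp: s(1) h(2) clin_zero[OF clin_tensor_left] clin_zero[OF clin_tensor_right])
    qed
  qed
  have "h t = t" if "t \<in> tensor_space R R" for t
  proof (rule clin_eq_on_span[OF h(1), of "\<lambda>t. t"])
    show "clin (\<lambda>t :: ('n gl, 'n gl) tensor. t)" by (rule clinI) simp_all
    show "t \<in> cvec.span {x \<otimes>\<^sub>C y | x y. x \<in> R \<and> y \<in> R}"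
      using that by (simp add: tensor_space_def)
  qed (auto simp: h(2) proj_id)
  moreover have "h t = 0" if "t \<in> ?W" for t
  proof -
    from that obtain a b c where t: "t = a + b + c" "a \<in> tensor_space R ?O"
      "b \<in> tensor_space ?O R" "c \<in> tensor_space ?O ?O" by blast
    have "h a = 0" "h b = 0" "h c = 0"
      by (rule zero[OF t(2)], simp add: proj_orth, rule zero[OF t(3)], simp add: proj_orth,
          rule zero[OF t(4)], simp add: proj_orth)
    then show ?thesis by (simp add: t(1) clin_add[OF h(1)])
  qed
  ultimately have "\<exists>p. clin p \<and> (\<forall>u\<in>tensor_space R R. p u = u) \<and> (\<forall>w\<in>?W. p w = 0)"
    using h(1) by blast
  from someI_ex[OF this] have p: "clin (Proj R)"
    "\<And>u. u \<in> tensor_space R R \<Longrightarrow> Proj R u = u" "\<And>w. w \<in> ?W \<Longrightarrow> Proj R w = 0"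
    unfolding Proj_def proj_along_def by auto
  show "clin (Proj R)" by (rule p(1))
  assume x: "x \<in> sl" and y: "y \<in> sl"
  define x' y' where "x' = x - proj x" and "y' = y - proj y"
  have x': "x' \<in> ?O" and y': "y' \<in> ?O" using x y by (simp_all add: x'_def y'_def orth_part)
  let ?w = "proj x \<otimes>\<^sub>C y' + x' \<otimes>\<^sub>C proj y + x' \<otimes>\<^sub>C y'"
  have "?w \<in> ?W" using x' y' proj_in tensor_in_tensor_space by blast
  have "x \<otimes>\<^sub>C y = (proj x + x') \<otimes>\<^sub>C (proj y + y')" by (simp add: x'_def y'_def)
  also have "\<dots> = proj x \<otimes>\<^sub>C proj y + ?w"
    by (simp only: clin_add[OF clin_tensor_left] clin_add[OF clin_tensor_right] ac_simps)
  finally have "Proj R (x \<otimes>\<^sub>C y) = Proj R (proj x \<otimes>\<^sub>C proj y) + Proj R ?w"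
    by (simp only: clin_add[OF p(1)])
  also have "\<dots> = proj x \<otimes>\<^sub>C proj y"
    using p(2)[OF tensor_in_tensor_space[OF proj_in proj_in]] p(3)[OF \<open>?w \<in> ?W\<close>] by simp
  finally show "Proj R (x \<otimes>\<^sub>C y) = proj x \<otimes>\<^sub>C proj y" .
qed

section \<open>Evaluation on \<open>\<delta>\<close>\<close>

text \<open>On \<open>sl \<otimes> sl\<close> the composite map sends \<open>x \<otimes> y\<close> to \<open>z \<mapsto> trace (proj y ** z) proj x\<close>.
  The bilinear map given by this formula on all matrices may be evaluated on the
  individual terms of \<open>\<delta>\<close>, whose factors need not be traceless.\<close>

lemma \<eta>_\<delta>_res_eq_sum:
  "(\<eta> \<circ> tensor_map sl sl id B_inv \<circ> \<delta>_res R) X z =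
    (\<Sum>i\<in>UNIV. \<Sum>j\<in>UNIV. X $ i $ j *\<^sub>C (1 / (2 * of_nat CARD('n))) *\<^sub>C
      (\<Sum>k\<in>UNIV. trace (proj (mat_unit k j) ** z) *\<^sub>C proj (mat_unit i k)
        - trace (proj (mat_unit i k) ** z) *\<^sub>C proj (mat_unit k j)))"
proof -
  let ?F = "\<lambda>t. \<eta> (tensor_map sl sl id B_inv (Proj R t)) :: 'n gl \<Rightarrow> 'n gl"
  let ?g = "\<lambda>x y z. trace (proj y ** z) *\<^sub>C proj x"
  have F: "clin ?F" by (intro clin_compose[OF clin_\<eta>] clin_compose[OF clin_tensor_map_B_inv] clin_Proj)
  have left: "clin (\<lambda>x. ?g x y)" for y
    by (rule clinI) (simp_all add: fun_eq_iff clin_add[OF clin_proj] clin_scale[OF clin_proj]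
        cvec.scale_right_distrib mult.commute)
  have right: "clin (?g x)" for x
    by (rule clinI) (simp_all add: fun_eq_iff clin_add[OF clin_proj] clin_scale[OF clin_proj]
        matrix_mult_add_left matrix_scaleC_left trace_add clin_scale[OF clin_trace]
        cvec.scale_left_distrib)
  obtain G where G: "clin G" "\<And>x y. G (x \<otimes>\<^sub>C y) = ?g x y"
    using bilinear_factors_through_tensor[of ?g, OF left right] by blast
  have "?F (\<delta> X) = G (\<delta> X)"
  proof (rule clin_eq_on_span[OF F G(1)])
    show "\<delta> X \<in> cvec.span {x \<otimes>\<^sub>C y | x y. x \<in> sl \<and> y \<in> sl}"
      using \<delta>_in_sl[of X] by (simp add: tensor_space_def)
    fix s :: "('n gl, 'n gl) tensor" assume "s \<in> {x \<otimes>\<^sub>C y | x y. x \<in> sl \<and> y \<in> sl}"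
    then obtain x y where s: "s = x \<otimes>\<^sub>C y" "x \<in> sl" "y \<in> sl" by blast
    have sl: "proj u \<in> sl" for u using proj_in traceless by blast
    have "?F s = (\<lambda>z. trace (proj y ** z) *\<^sub>C proj x)"
      by (simp add: s Proj_tensor tensor_map_B_inv sl \<eta>_tensor trace_mult_in_sl_dual)
    then show "?F s = G s" by (simp add: s(1) G(2))
  qed
  moreover have "G (\<delta> X) = (\<Sum>i\<in>UNIV. \<Sum>j\<in>UNIV. X $ i $ j *\<^sub>C (1 / (2 * of_nat CARD('n))) *\<^sub>C
      (\<Sum>k\<in>UNIV. ?g (mat_unit i k) (mat_unit k j) - ?g (mat_unit k j) (mat_unit i k)))"
    by (simp only: \<delta>_def clin_sum[OF G(1)] clin_scale[OF G(1)] clin_diff[OF G(1)] G(2))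
  moreover have sum_apply: "(\<Sum>i\<in>I. f i) z = (\<Sum>i\<in>I. f i z)" for I and f :: "'n \<Rightarrow> 'n gl \<Rightarrow> 'n gl"
    by (induction I rule: infinite_finite_induct) auto
  ultimately show ?thesis by (simp add: \<delta>_res_def sum_apply)
qed

lemma \<eta>_\<delta>_res_orth:
  assumes "z \<in> orth R"
  shows "(\<eta> \<circ> tensor_map sl sl id B_inv \<circ> \<delta>_res R) X z = 0"
proof -
  have "trace (proj Y ** z) = 0" for Y
    using assms proj_in trace_mul_sym[of "proj Y" z] by (simp add: orth_eq)
  then show ?thesis unfolding \<eta>_\<delta>_res_eq_sum by simp
qed

text \<open>For \<open>z\<close> in \<open>R\<close> the inner projections disappear under the trace, and
  \<open>trace (E\<^sub>k\<^sub>j z)\<close> is an entry of \<open>z\<close>; the two sums are the matrix products \<open>X z\<close> and \<open>z X\<close>.\<close>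

lemma \<eta>_\<delta>_res_eq_commutator:
  assumes X: "X \<in> R" and z: "z \<in> R"
  shows "(2 * of_nat CARD('n)) *\<^sub>C (\<eta> \<circ> tensor_map sl sl id B_inv \<circ> \<delta>_res R) X z = commutator X z"
proof -
  let ?n = "2 * of_nat CARD('n) :: complex"
  have n: "?n \<noteq> 0" by simp
  have "(\<eta> \<circ> tensor_map sl sl id B_inv \<circ> \<delta>_res R) X z = (\<Sum>i\<in>UNIV. \<Sum>j\<in>UNIV. X $ i $ j *\<^sub>C (1 / ?n) *\<^sub>C
      (\<Sum>k\<in>UNIV. z $ j $ k *\<^sub>C proj (mat_unit i k) - z $ k $ i *\<^sub>C proj (mat_unit k j)))"
    by (simp only: \<eta>_\<delta>_res_eq_sum trace_proj[OF z] trace_mat_unit_mult)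
  also have "\<dots> = (1 / ?n) *\<^sub>C proj (\<Sum>i\<in>UNIV. \<Sum>j\<in>UNIV. \<Sum>k\<in>UNIV.
      (X $ i $ j * z $ j $ k) *\<^sub>C mat_unit i k - (X $ i $ j * z $ k $ i) *\<^sub>C mat_unit k j)"
    by (simp add: clin_sum[OF clin_proj] clin_diff[OF clin_proj] clin_scale[OF clin_proj]
        cvec.scale_sum_right cvec.scale_right_diff_distrib mult.left_commute mult.assoc)
  also have "(\<Sum>i\<in>UNIV. \<Sum>j\<in>UNIV. \<Sum>k\<in>UNIV.
      (X $ i $ j * z $ j $ k) *\<^sub>C mat_unit i k - (X $ i $ j * z $ k $ i) *\<^sub>C mat_unit k j)
      = commutator X z"
  proof -
    have "(\<Sum>i\<in>UNIV. \<Sum>j\<in>UNIV. \<Sum>k\<in>UNIV. (X $ i $ j * z $ j $ k) *\<^sub>C mat_unit i k)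
        = (\<Sum>i\<in>UNIV. \<Sum>k\<in>UNIV. \<Sum>j\<in>UNIV. (X $ i $ j * z $ j $ k) *\<^sub>C mat_unit i k)"
      by (intro sum.cong refl sum.swap)
    also have "\<dots> = X ** z"
      by (subst matrix_expansion[of "X ** z", symmetric])
        (simp add: matrix_matrix_mult_def cvec.scale_sum_left)
    finally have 1: "(\<Sum>i\<in>UNIV. \<Sum>j\<in>UNIV. \<Sum>k\<in>UNIV. (X $ i $ j * z $ j $ k) *\<^sub>C mat_unit i k) = X ** z" .
    have "(\<Sum>i\<in>UNIV. \<Sum>j\<in>UNIV. \<Sum>k\<in>UNIV. (X $ i $ j * z $ k $ i) *\<^sub>C mat_unit k j)
        = (\<Sum>j\<in>UNIV. \<Sum>i\<in>UNIV. \<Sum>k\<in>UNIV. (X $ i $ j * z $ k $ i) *\<^sub>C mat_unit k j)"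
      by (rule sum.swap)
    also have "\<dots> = (\<Sum>j\<in>UNIV. \<Sum>k\<in>UNIV. \<Sum>i\<in>UNIV. (X $ i $ j * z $ k $ i) *\<^sub>C mat_unit k j)"
      by (intro sum.cong refl sum.swap)
    also have "\<dots> = (\<Sum>k\<in>UNIV. \<Sum>j\<in>UNIV. \<Sum>i\<in>UNIV. (X $ i $ j * z $ k $ i) *\<^sub>C mat_unit k j)"
      by (rule sum.swap)
    also have "\<dots> = z ** X"
      by (subst matrix_expansion[of "z ** X", symmetric])
        (simp add: matrix_matrix_mult_def cvec.scale_sum_left mult.commute)
    finally show ?thesis by (simp add: commutator_def sum_subtractf 1)
  qed
  also have "proj (commutator X z) = commutator X z"
    using X z by (intro proj_id commutator_closed)
  finally have "(\<eta> \<circ> tensor_map sl sl id B_inv \<circ> \<delta>_res R) X z = (1 / ?n) *\<^sub>C commutator X z" .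
  then show ?thesis using n by (simp only:) (simp add: scaleC_scaleC scaleC_one)
qed

end

theorem theorem6p2:
  fixes bracket :: "'l::complex_vector \<Rightarrow> 'l \<Rightarrow> 'l"
    and act :: "'l \<Rightarrow> 'v::complex_vector \<Rightarrow> 'v"
    and b :: "'n::finite \<Rightarrow> 'v"
    and \<rho> :: "'l \<Rightarrow> complex ^ 'n ^ 'n"
    and T :: "complex ^ 'n ^ 'n \<Rightarrow> complex ^ 'n ^ 'n \<Rightarrow> complex ^ 'n ^ 'n"
  assumes "simple_lie_algebra bracket" and "finite_dim (UNIV :: 'l set)"
    and "irreducible_lie_module bracket act" and "\<exists>x v. act x v \<noteq> 0"
    and "is_basis b"
    and "\<rho> = rep_matrix b act"
    and "T = (\<lambda>X. (2 * of_nat CARD('n)) *\<^sub>C (\<eta> \<circ> tensor_map sl sl id B_inv \<circ> \<delta>_res (range \<rho>)) X)"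
  shows "(\<forall>X\<in>range \<rho>. \<forall>z\<in>sl. T X z = ad_res (range \<rho>) X z) \<and>
    (\<forall>x y. \<forall>m\<in>orth (range \<rho>). T (\<rho> x) (\<rho> y + m) = commutator (\<rho> x) (\<rho> y))"
proof -
  interpret simple_lie_algebra bracket by (rule assms(1))
  interpret irreducible_lie_module bracket act by (rule assms(3))
  interpret rep: simple_irreducible_representation bracket act b
    by unfold_locales (rule assms)+
  let ?R = "range \<rho>"
  interpret R: nondegenerate_matrix_lie_algebra ?R
  proof
    show "cvec.subspace ?R" unfolding assms(6) by (rule subspace_range_rep_matrix[OF assms(5)])
    show "?R \<subseteq> sl" unfolding assms(6) by (rule rep.range_\<rho>_subset_sl)
    show "commutator X Y \<in> ?R" if "X \<in> ?R" "Y \<in> ?R" for X Y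
      using that unfolding assms(6) by (rule commutator_in_range_rep_matrix[OF assms(5)])
    show "X = 0" if "X \<in> ?R" "\<And>Y. Y \<in> ?R \<Longrightarrow> trace (X ** Y) = 0" for X
      using that unfolding assms(6) by (rule rep.trace_form_nondegenerate)
  qed
  let ?S = "\<eta> \<circ> tensor_map sl sl id B_inv \<circ> \<delta>_res ?R"
  have T: "T X (r + m) = commutator X r" if "X \<in> ?R" "r \<in> ?R" "m \<in> orth ?R" for X r m
  proof -
    have add: "?S X (r + m) = ?S X r + ?S X m"
      by (simp only: R.\<eta>_\<delta>_res_eq_sum clin_add[OF clin_trace_mult] cvec.scale_left_distrib
          sum.distrib[symmetric] cvec.scale_right_distrib[symmetric] add_diff_add)
    have "T X (r + m) = (2 * of_nat CARD('n)) *\<^sub>C ?S X (r + m)"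
      by (simp only: assms(7) fun_scaleC_apply)
    also have "\<dots> = commutator X r"
      unfolding add R.\<eta>_\<delta>_res_orth[OF that(3)]
      using R.\<eta>_\<delta>_res_eq_commutator[OF that(1,2)] by simp
    finally show ?thesis .
  qed
  show ?thesis
  proof (intro conjI ballI allI)
    fix X z assume X: "X \<in> ?R" and z: "z \<in> (sl :: 'n gl set)"
    have "T X z = T X (R.proj z + (z - R.proj z))" by simp
    also have "\<dots> = commutator X (R.proj z)" using X R.proj_in R.orth_part[OF z] by (rule T)
    finally show "T X z = ad_res ?R X z" by (simp add: ad_res_def R.proj_along_eq[OF z])
  next
    show "T (\<rho> x) (\<rho> y + m) = commutator (\<rho> x) (\<rho> y)" if "m \<in> orth ?R" for x y m
      using that by (intro T) auto
  qed
qed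

end
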